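(* Let $H$, $c$, $C=H-e_1c^T$ and $p(x)=\nu_n\det(xI-C)$ be as in the context, with $H$ normal. Let $C+\delta C=H+\delta H-(e_1+\delta e_1)(c+\delta c)^T$ with $\|\delta H\|_2\le\epsilon_H<1$, $\|\delta c\|_2\le\epsilon_c$, $\|\delta e_1\|_2\le\epsilon_1$, and let $(p+\delta p)(x)=\nu_n\det(xI-C-\delta C)$ be the perturbed polynomial. Then for every $\xi\in\mathbb{C}$ that is not a root of $\phi_n$, $$|\delta p(\xi)|\le\Gamma_1(\xi)\epsilon_1+\Gamma_c(\xi)\epsilon_c+\Gamma_H(\xi)\epsilon_H+O(\epsilon_H^2+\epsilon_1^2+\epsilon_c^2),$$ where $$\Gamma_1(\xi):=M(\xi)\,|\phi_n(\xi)|\,\|c\|_2,\qquad \Gamma_c(\xi):=|\chi|\,\|\Phi(\xi)\|_2,$$ $$\Gamma_H(\xi):=S(\xi)\,|\phi_n(\xi)|+\Gamma_c(\xi)\,[M(\xi)+S(\xi)]\,\|c\|_2,$$ $$S(\xi):=\sum_{j=1}^n\frac1{|\xi-r_j|},\qquad M(\xi):=\max_{j=1,\dots,n}\frac1{|\xi-r_j|},$$ and $r_1,\dots,r_n$ are the roots of the degree-$n$ polynomial $\phi_n$.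
   Context: Let $n\ge1$ and let $\phi_0,\dots,\phi_n$ be real polynomials with $\deg\phi_j=j$ and leading coefficients $\nu_j\neq0$. Put $\chi=\nu_n\nu_{n-1}^{-1}$ and $\Phi(x)=[\phi_{n-1}(x),\dots,\phi_1(x),\phi_0(x)]^T$. $H$ is the unique constant $n\times n$ matrix with $H\Phi(x)=x\Phi(x)-\chi^{-1}\phi_n(x)e_1$, so that $\phi_n(x)=\nu_n\det(xI-H)$; it is a standing assumption that $H$ is normal. The vector $c$ has length $n$, $C=H-e_1c^T$ and $p(x)=\nu_n\det(xI-C)$ (equivalently $p=\phi_n+\chi c^T\Phi$, i.e. the factor $\chi^{-1}$ of the confederate matrix is absorbed in $c$). The perturbations $\delta H$ ($n\times n$ matrix), $\delta e_1,\delta c$ (vectors of length $n$) are real or complex. The $O(\cdot)$ term is for fixed basis, $c$ and $\xi$, as $\epsilon_H,\epsilon_1,\epsilon_c\to0$, uniformly over all perturbations satisfying the norm bounds. *)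

theory Defs
  imports
    Complex_Main
    "HOL-Library.Landau_Symbols"
    "HOL-Analysis.L2_Norm"
    "Jordan_Normal_Form.Char_Poly"
    "Jordan_Normal_Form.Schur_Decomposition"
begin

section \<open>Norms and normal matrices\<close>

definition vnorm2 :: "complex vec \<Rightarrow> real" where
  "vnorm2 v = L2_set (\<lambda>i. cmod (v $ i)) {..<dim_vec v}"

definition mnorm2 :: "complex mat \<Rightarrow> real" where
  "mnorm2 A = (SUP v \<in> {v \<in> carrier_vec (dim_col A). vnorm2 v \<le> 1}. vnorm2 (A *\<^sub>v v))"

definition normal_mat :: "complex mat \<Rightarrow> bool" where
  "normal_mat A \<longleftrightarrow> A * mat_adjoint A = mat_adjoint A * A"

text \<open>The rank-one matrix \<open>u v\<^sup>T\<close>; there is no complex conjugation of \<open>v\<close>.\<close>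

definition outer :: "complex vec \<Rightarrow> complex vec \<Rightarrow> complex mat" where
  "outer u v = mat (dim_vec u) (dim_vec v) (\<lambda>(i, j). u $ i * v $ j)"


section \<open>Degree-graded bases and their confederate matrices\<close>

definition degree_graded :: "nat \<Rightarrow> (nat \<Rightarrow> real poly) \<Rightarrow> bool" where
  "degree_graded n \<phi> \<longleftrightarrow> (\<forall>j\<le>n. degree (\<phi> j) = j \<and> lead_coeff (\<phi> j) \<noteq> 0)"

abbreviation cpoly :: "real poly \<Rightarrow> complex poly" where
  "cpoly \<equiv> map_poly complex_of_real"

definition chi :: "nat \<Rightarrow> (nat \<Rightarrow> real poly) \<Rightarrow> complex" where
  "chi n \<phi> = complex_of_real (lead_coeff (\<phi> n) / lead_coeff (\<phi> (n - 1)))"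

text \<open>Matrix and vector indices start at \<open>0\<close>, so the entries of the vector below are
  \<open>\<phi> (n - 1), \<dots>, \<phi> 0\<close> in this order, and \<open>unit_vec n 0\<close> is the first
  standard basis vector.\<close>

definition Phi :: "nat \<Rightarrow> (nat \<Rightarrow> real poly) \<Rightarrow> complex \<Rightarrow> complex vec" where
  "Phi n \<phi> x = vec n (\<lambda>i. poly (cpoly (\<phi> (n - 1 - i))) x)"

text \<open>The identity below determines \<open>H\<close> uniquely, also among complex matrices, because
  \<open>\<phi> 0, \<dots>, \<phi> (n - 1)\<close> are linearly independent; its entries are then real.\<close>

definition confederate :: "nat \<Rightarrow> (nat \<Rightarrow> real poly) \<Rightarrow> complex mat \<Rightarrow> bool" where
  "confederate n \<phi> H \<longleftrightarrow> H \<in> carrier_mat n n \<and>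
     (\<forall>x. H *\<^sub>v Phi n \<phi> x =
          x \<cdot>\<^sub>v Phi n \<phi> x - (inverse (chi n \<phi>) * poly (cpoly (\<phi> n)) x) \<cdot>\<^sub>v unit_vec n 0)"

text \<open>\<open>\<nu>\<^sub>n det (x I - A)\<close>, with \<open>\<nu>\<^sub>n\<close> the leading coefficient of \<open>\<phi> n\<close>.\<close>

definition det_poly :: "nat \<Rightarrow> (nat \<Rightarrow> real poly) \<Rightarrow> complex mat \<Rightarrow> complex \<Rightarrow> complex" where
  "det_poly n \<phi> A x = complex_of_real (lead_coeff (\<phi> n)) * det (x \<cdot>\<^sub>m 1\<^sub>m n - A)"

text \<open>\<open>r 1, \<dots>, r n\<close> lists the complex roots of \<open>\<phi> n\<close>, with multiplicity.\<close>

definition roots_of :: "nat \<Rightarrow> (nat \<Rightarrow> real poly) \<Rightarrow> (nat \<Rightarrow> complex) \<Rightarrow> bool" where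
  "roots_of n \<phi> r \<longleftrightarrow>
     cpoly (\<phi> n) = smult (complex_of_real (lead_coeff (\<phi> n))) (\<Prod>j=1..n. [:- r j, 1:])"


section \<open>The first-order coefficients\<close>

definition S_sum :: "nat \<Rightarrow> (nat \<Rightarrow> complex) \<Rightarrow> complex \<Rightarrow> real" where
  "S_sum n r \<xi> = (\<Sum>j=1..n. 1 / cmod (\<xi> - r j))"

definition M_max :: "nat \<Rightarrow> (nat \<Rightarrow> complex) \<Rightarrow> complex \<Rightarrow> real" where
  "M_max n r \<xi> = (MAX j\<in>{1..n}. 1 / cmod (\<xi> - r j))"

definition Gamma_1 ::
  "nat \<Rightarrow> (nat \<Rightarrow> real poly) \<Rightarrow> (nat \<Rightarrow> complex) \<Rightarrow> complex vec \<Rightarrow> complex \<Rightarrow> real" where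
  "Gamma_1 n \<phi> r c \<xi> = M_max n r \<xi> * cmod (poly (cpoly (\<phi> n)) \<xi>) * vnorm2 c"

definition Gamma_c :: "nat \<Rightarrow> (nat \<Rightarrow> real poly) \<Rightarrow> complex \<Rightarrow> real" where
  "Gamma_c n \<phi> \<xi> = cmod (chi n \<phi>) * vnorm2 (Phi n \<phi> \<xi>)"

definition Gamma_H ::
  "nat \<Rightarrow> (nat \<Rightarrow> real poly) \<Rightarrow> (nat \<Rightarrow> complex) \<Rightarrow> complex vec \<Rightarrow> complex \<Rightarrow> real" where
  "Gamma_H n \<phi> r c \<xi> =
     S_sum n r \<xi> * cmod (poly (cpoly (\<phi> n)) \<xi>)
     + Gamma_c n \<phi> \<xi> * (M_max n r \<xi> + S_sum n r \<xi>) * vnorm2 c"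

end

theory Submission
  imports Defs
begin

text \<open>Let \<open>A = \<xi> I - H\<close>, \<open>X = A - \<delta>H\<close>, \<open>z\<^sub>0 = A\<^sup>-\<^sup>1 e\<^sub>1\<close>, which is \<open>\<chi> \<Phi>(\<xi>) / \<phi>\<^sub>n(\<xi>)\<close>, and
  \<open>z = X\<^sup>-\<^sup>1 (e\<^sub>1 + \<delta>e\<^sub>1)\<close>. The perturbed determinant is \<open>det X (1 + (c + \<delta>c)\<^sup>T z)\<close>, so it suffices to
  expand the two factors to first order. In an orthonormal eigenbasis of \<open>H\<close> one reads off
  \<open>det X = det A (1 - tr (A\<^sup>-\<^sup>1 \<delta>H) + O(\<epsilon>\<^sub>H\<^sup>2))\<close> with \<open>|tr (A\<^sup>-\<^sup>1 \<delta>H)| \<le> S \<epsilon>\<^sub>H\<close>, and \<open>\<parallel>A\<^sup>-\<^sup>1\<parallel> \<le> M\<close>. The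
  equation \<open>A z - \<delta>H z = e\<^sub>1 + \<delta>e\<^sub>1\<close> expands \<open>z\<close> around \<open>z\<^sub>0\<close> without differentiating an inverse.\<close>

section \<open>The Euclidean and the spectral norm\<close>

text \<open>The first-order terms come from four places. \<open>\<delta>e\<^sub>1\<close> enters
  through \<open>c\<^sup>T A\<^sup>-\<^sup>1 \<delta>e\<^sub>1\<close>, of size at most M times the
  norm of c. \<open>\<delta>c\<close> enters through \<open>\<delta>c\<^sup>T z\<^sub>0\<close>, and
  the norm of \<open>z\<^sub>0\<close> times the modulus of \<open>\<phi>\<^sub>n(\<xi>)\<close> is
  \<open>Gamma_c\<close>. \<open>\<delta>H\<close> enters twice: through the trace, multiplied by
  \<open>1 + c\<^sup>T z\<^sub>0\<close>, and through
  \<open>c\<^sup>T A\<^sup>-\<^sup>1 \<delta>H z\<^sub>0\<close>; this explains the shape of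
  \<open>Gamma_H\<close>. Normality provides a unitary eigenbasis. In it the entries of a
  perturbation stay below its spectral norm, so no condition number of eigenvectors appears. That
  the eigenvalues of H are the roots of \<open>\<phi> n\<close> has to be derived from the
  confederate identity. The obstacle is uniformity: one function R of the three bounds must serve
  all perturbations, also for bounds far from 0 where the expansion fails. Hence all constants
  depend only on A, e, c and the bounds M, S, K, and a crude determinant estimate covers the
  rest.\<close>

lemma vnorm2_nonneg [simp]: "0 \<le> vnorm2 v"
  by (simp add: vnorm2_def L2_set_nonneg)

lemma vnorm2_power2: "(vnorm2 v)\<^sup>2 = (\<Sum>i<dim_vec v. (cmod (v $ i))\<^sup>2)"
  by (simp add: vnorm2_def L2_set_def sum_nonneg)

lemma complex_vnorm2_power2: "complex_of_real ((vnorm2 v)\<^sup>2) = v \<bullet>c v"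
  unfolding vnorm2_power2 scalar_prod_def of_real_sum
  by (simp add: complex_norm_square atLeast0LessThan flip: of_real_power cong: sum.cong_simp)

lemma vnorm2_add_le:
  assumes "dim_vec v = dim_vec w"
  shows "vnorm2 (v + w) \<le> vnorm2 v + vnorm2 w"
proof -
  have "vnorm2 (v + w) \<le> L2_set (\<lambda>i. cmod (v $ i) + cmod (w $ i)) {..<dim_vec w}"
    unfolding vnorm2_def using assms by (auto intro!: L2_set_mono norm_triangle_ineq)
  also have "\<dots> \<le> vnorm2 v + vnorm2 w"
    unfolding vnorm2_def assms by (rule L2_set_triangle_ineq)
  finally show ?thesis .
qed

lemma vnorm2_smult: "vnorm2 (a \<cdot>\<^sub>v v) = cmod a * vnorm2 v"
  unfolding vnorm2_def by (auto simp: norm_mult L2_set_right_distrib intro!: L2_set_cong)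

lemma vnorm2_uminus [simp]: "vnorm2 (- v) = vnorm2 v"
  unfolding vnorm2_def by (auto intro!: L2_set_cong)

lemma vnorm2_diff_le:
  assumes "dim_vec v = dim_vec w"
  shows "vnorm2 (v - w) \<le> vnorm2 v + vnorm2 w"
proof -
  have "v - w = v + - w" using assms by auto
  then show ?thesis using vnorm2_add_le[of v "- w"] assms by simp
qed

lemma vnorm2_eq_0_iff: "vnorm2 v = 0 \<longleftrightarrow> v = 0\<^sub>v (dim_vec v)"
proof
  assume "vnorm2 v = 0"
  then show "v = 0\<^sub>v (dim_vec v)" by (auto simp: vnorm2_def L2_set_eq_0_iff)
next
  assume v: "v = 0\<^sub>v (dim_vec v)"
  show "vnorm2 v = 0" by (subst v) (auto simp: vnorm2_def L2_set_eq_0_iff)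
qed

lemma vnorm2_zero [simp]: "vnorm2 (0\<^sub>v n) = 0"
  by (simp add: vnorm2_eq_0_iff)

lemma cmod_index_le_vnorm2:
  assumes "i < dim_vec v"
  shows "cmod (v $ i) \<le> vnorm2 v"
  unfolding vnorm2_def using assms by (intro member_le_L2_set) auto

lemma vnorm2_unit_vec [simp]:
  assumes "i < n"
  shows "vnorm2 (unit_vec n i) = 1"
proof -
  have "(vnorm2 (unit_vec n i))\<^sup>2 = (\<Sum>j<n. if j = i then 1 else 0)"
    unfolding vnorm2_power2 using assms by (intro sum.cong) auto
  also have "\<dots> = 1\<^sup>2" using assms by simp
  finally show ?thesis by (metis power2_eq_iff_nonneg vnorm2_nonneg zero_le_one)
qed

text \<open>Cauchy-Schwarz for the bilinear product, without conjugation: the real inequality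
  applied to the moduli of the entries suffices.\<close>

lemma cmod_scalar_prod_le:
  assumes "dim_vec v = dim_vec w"
  shows "cmod (v \<bullet> w) \<le> vnorm2 v * vnorm2 w"
proof -
  have "cmod (v \<bullet> w) \<le> (\<Sum>i<dim_vec w. \<bar>cmod (v $ i)\<bar> * \<bar>cmod (w $ i)\<bar>)"
    unfolding scalar_prod_def atLeast0LessThan by (rule sum_norm_le) (simp add: norm_mult)
  also have "\<dots> \<le> vnorm2 v * vnorm2 w"
    unfolding vnorm2_def assms by (rule L2_set_mult_ineq)
  finally show ?thesis .
qed

text \<open>A real \<open>SUP\<close> is meaningful only for a set bounded above. Cauchy-Schwarz on
  each row supplies the bound.\<close>

lemma bdd_above_mnorm2:
  "bdd_above ((\<lambda>v. vnorm2 (A *\<^sub>v v)) ` {v \<in> carrier_vec (dim_col A). vnorm2 v \<le> 1})"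
proof (rule bdd_aboveI2)
  fix v assume v: "v \<in> {v \<in> carrier_vec (dim_col A). vnorm2 v \<le> 1}"
  have "vnorm2 (A *\<^sub>v v) \<le> (\<Sum>i<dim_row A. cmod ((A *\<^sub>v v) $ i))"
    unfolding vnorm2_def dim_mult_mat_vec by (rule L2_set_le_sum) simp
  also have "\<dots> \<le> (\<Sum>i<dim_row A. vnorm2 (row A i))"
  proof (rule sum_mono)
    fix i assume i: "i \<in> {..<dim_row A}"
    have "cmod ((A *\<^sub>v v) $ i) \<le> vnorm2 (row A i) * vnorm2 v"
      using i v cmod_scalar_prod_le[of "row A i" v] by auto
    also have "\<dots> \<le> vnorm2 (row A i)" using v by (simp add: mult_left_le)
    finally show "cmod ((A *\<^sub>v v) $ i) \<le> vnorm2 (row A i)" .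
  qed
  finally show "vnorm2 (A *\<^sub>v v) \<le> (\<Sum>i<dim_row A. vnorm2 (row A i))" .
qed

text \<open>The supremum controls the unit ball only, so \<open>v\<close> is rescaled into it; the
  zero vector cannot be normalised and is treated separately.\<close>

lemma vnorm2_mult_le:
  assumes "v \<in> carrier_vec (dim_col A)"
  shows "vnorm2 (A *\<^sub>v v) \<le> mnorm2 A * vnorm2 v"
proof (cases "vnorm2 v = 0")
  case True
  then have v: "v = 0\<^sub>v (dim_col A)" using assms by (simp add: vnorm2_eq_0_iff)
  have "A *\<^sub>v v = 0\<^sub>v (dim_row A)"
    unfolding v by (intro eq_vecI) (auto intro!: scalar_prod_right_zero row_carrier)
  then show ?thesis using True by simp
next
  case False
  then have pos: "vnorm2 v > 0" by (simp add: order_less_le)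
  let ?w = "complex_of_real (1 / vnorm2 v) \<cdot>\<^sub>v v"
  have w: "?w \<in> {v \<in> carrier_vec (dim_col A). vnorm2 v \<le> 1}"
    using assms pos by (simp add: vnorm2_smult norm_divide)
  have v: "v = complex_of_real (vnorm2 v) \<cdot>\<^sub>v ?w" using pos by (simp add: smult_smult_assoc)
  have "A *\<^sub>v v = complex_of_real (vnorm2 v) \<cdot>\<^sub>v (A *\<^sub>v ?w)"
    by (subst (1) v, rule mult_mat_vec[of _ "dim_row A" "dim_col A"]) (use assms in auto)
  then have "vnorm2 (A *\<^sub>v v) = vnorm2 v * vnorm2 (A *\<^sub>v ?w)" by (simp only: vnorm2_smult) simp
  also have "\<dots> \<le> vnorm2 v * mnorm2 A"
    unfolding mnorm2_def by (intro mult_left_mono cSUP_upper[OF w bdd_above_mnorm2]) simp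
  finally show ?thesis by (simp add: mult.commute)
qed

lemma mnorm2_nonneg: "0 \<le> mnorm2 A"
proof -
  have "vnorm2 (A *\<^sub>v 0\<^sub>v (dim_col A)) \<le> mnorm2 A"
    unfolding mnorm2_def by (rule cSUP_upper[OF _ bdd_above_mnorm2]) simp
  then show ?thesis using vnorm2_nonneg order_trans by blast
qed

lemma col_eq_mult_unit_vec:
  fixes A :: "'a :: semiring_1 mat"
  assumes "j < dim_col A"
  shows "col A j = A *\<^sub>v unit_vec (dim_col A) j"
  using assms by (intro eq_vecI) (auto simp: scalar_prod_right_unit)

text \<open>The entry is a coordinate of the image of a unit vector. This is how spectral norms
  enter the entrywise determinant estimates.\<close>

lemma cmod_index_le_mnorm2:
  assumes "i < dim_row A" "j < dim_col A"
  shows "cmod (A $$ (i, j)) \<le> mnorm2 A"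
proof -
  have "cmod (A $$ (i, j)) = cmod (col A j $ i)" using assms by simp
  also have "\<dots> \<le> vnorm2 (col A j)" using assms by (intro cmod_index_le_vnorm2) simp
  also have "\<dots> \<le> mnorm2 A"
    using vnorm2_mult_le[of "unit_vec (dim_col A) j" A] assms by (simp add: col_eq_mult_unit_vec)
  finally show ?thesis .
qed

lemma mnorm2_le:
  assumes "0 \<le> k" "\<And>v. v \<in> carrier_vec (dim_col A) \<Longrightarrow> vnorm2 (A *\<^sub>v v) \<le> k * vnorm2 v"
  shows "mnorm2 A \<le> k"
  unfolding mnorm2_def
proof (rule cSUP_least)
  show "{v \<in> carrier_vec (dim_col A). vnorm2 v \<le> 1} \<noteq> {}"
    by (auto intro!: exI[of _ "0\<^sub>v (dim_col A)"])
next
  fix v assume v: "v \<in> {v \<in> carrier_vec (dim_col A). vnorm2 v \<le> 1}"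
  then have "vnorm2 (A *\<^sub>v v) \<le> k * vnorm2 v" using assms by blast
  also have "\<dots> \<le> k" using v assms by (simp add: mult_left_le)
  finally show "vnorm2 (A *\<^sub>v v) \<le> k" .
qed

section \<open>Adjoints and unitary matrices\<close>

lemma dim_mat_adjoint [simp]:
  "dim_row (mat_adjoint A) = dim_col A" "dim_col (mat_adjoint A) = dim_row A"
  by (simp_all add: mat_adjoint_def)

lemma index_mat_adjoint [simp]:
  assumes "i < dim_col A" "j < dim_row A"
  shows "mat_adjoint A $$ (i, j) = conjugate (A $$ (j, i))"
  using assms by (simp add: mat_adjoint_def mat_of_rows_index)

lemma mat_adjoint_carrier [simp]: "A \<in> carrier_mat m n \<Longrightarrow> mat_adjoint A \<in> carrier_mat n m"
  by (auto intro!: carrier_matI)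

lemma mat_adjoint_adjoint [simp]: "mat_adjoint (mat_adjoint A) = A"
  by (rule eq_matI) auto

lemma mat_adjoint_mult:
  fixes A B :: "complex mat"
  assumes "A \<in> carrier_mat m n" "B \<in> carrier_mat n k"
  shows "mat_adjoint (A * B) = mat_adjoint B * mat_adjoint A"
  by (rule eq_matI) (use assms in \<open>auto simp: scalar_prod_def mult.commute\<close>)

lemma cscalar_prod_mult_adjoint:
  fixes A :: "complex mat"
  assumes "A \<in> carrier_mat m n" "v \<in> carrier_vec n" "w \<in> carrier_vec m"
  shows "(A *\<^sub>v v) \<bullet>c w = v \<bullet>c (mat_adjoint A *\<^sub>v w)"
proof -
  have "(A *\<^sub>v v) \<bullet>c w = (\<Sum>i<m. \<Sum>j<n. A $$ (i, j) * v $ j * cnj (w $ i))"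
    using assms by (simp add: scalar_prod_def sum_distrib_right atLeast0LessThan)
  also have "\<dots> = (\<Sum>j<n. \<Sum>i<m. A $$ (i, j) * v $ j * cnj (w $ i))"
    by (rule sum.swap)
  also have "\<dots> = v \<bullet>c (mat_adjoint A *\<^sub>v w)"
    using assms by (simp add: scalar_prod_def sum_distrib_left atLeast0LessThan mult_ac)
  finally show ?thesis .
qed

lemma vnorm2_unitary:
  assumes "U \<in> carrier_mat n n" "mat_adjoint U * U = 1\<^sub>m n" "v \<in> carrier_vec n"
  shows "vnorm2 (U *\<^sub>v v) = vnorm2 v"
proof -
  have "complex_of_real ((vnorm2 (U *\<^sub>v v))\<^sup>2) = v \<bullet>c (mat_adjoint U *\<^sub>v (U *\<^sub>v v))"
    unfolding complex_vnorm2_power2 using assms by (intro cscalar_prod_mult_adjoint) auto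
  also have "mat_adjoint U *\<^sub>v (U *\<^sub>v v) = v"
    using assms by (simp flip: assoc_mult_mat_vec[of _ n n])
  finally have "(vnorm2 (U *\<^sub>v v))\<^sup>2 = (vnorm2 v)\<^sup>2"
    unfolding complex_vnorm2_power2[symmetric] of_real_eq_iff .
  then show ?thesis by simp
qed

text \<open>Needed because \<open>\<delta>H\<close> enters the matrix
  \<open>\<xi> I - C - \<delta>C\<close> with a minus sign.\<close>

lemma mnorm2_uminus_le:
  assumes "A \<in> carrier_mat m n"
  shows "mnorm2 (- A) \<le> mnorm2 A"
proof (rule mnorm2_le[OF mnorm2_nonneg])
  fix v :: "complex vec" assume "v \<in> carrier_vec (dim_col (- A))"
  then show "vnorm2 (- A *\<^sub>v v) \<le> mnorm2 A * vnorm2 v"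
    using vnorm2_mult_le[of v A] by (simp add: uminus_mult_mat_vec)
qed

section \<open>Unitary diagonalization of normal matrices\<close>

lemma mult_square_mat_carrier [simp]:
  "A \<in> carrier_mat n n \<Longrightarrow> B \<in> carrier_mat n n \<Longrightarrow> A * B \<in> carrier_mat n n"
  by (rule mult_carrier_mat)

text \<open>Cancellation in the shape that right-nested products have after rewriting with
  associativity.\<close>

lemma mult_mat_left_cancel_inverse:
  fixes A :: "'a :: semiring_1 mat"
  assumes "A * B = 1\<^sub>m n" "A \<in> carrier_mat n n" "B \<in> carrier_mat n n" "X \<in> carrier_mat n k"
  shows "A * (B * X) = X"
  using assms by (metis assoc_mult_mat left_mult_one_mat)

text \<open>Complete \<open>v\<close> to a basis and orthogonalise. Gram-Schmidt keeps the head
  \<open>v\<close> and yields orthogonal but not normalised vectors, so each column is scaled by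
  \<open>s i\<close>; the scalar \<open>a\<close> is the reciprocal of the norm of
  \<open>v\<close>.\<close>

lemma exists_unitary_first_column:
  fixes v :: "complex vec"
  assumes v: "v \<in> carrier_vec n" "v \<noteq> 0\<^sub>v n"
  obtains W a where "W \<in> carrier_mat n n" "mat_adjoint W * W = 1\<^sub>m n" "col W 0 = a \<cdot>\<^sub>v v"
proof -
  interpret cof_vec_space n "TYPE(complex)" .
  note bc = basis_completion[OF v]
  define ws where "ws = gram_schmidt n (basis_completion v)"
  have ws: "set ws \<subseteq> carrier_vec n" "corthogonal ws" "length ws = n"
    using gram_schmidt_result[OF bc(2,4,5), of ws] bc(6) by (auto simp: ws_def)
  have n0: "n \<noteq> 0" using v by (metis carrier_vecD eq_vecI less_nat_zero_code zero_carrier_vec)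
  then obtain vs where "basis_completion v = v # vs"
    using bc(6,7) by (cases "basis_completion v") auto
  then have ws0: "ws ! 0 = v"
    using gram_schmidt_hd[OF v(1), of vs] n0 ws(3) by (metis ws_def hd_conv_nth length_0_conv)
  have wsc: "ws ! i \<in> carrier_vec n" if "i < n" for i using ws that by auto
  have wn0: "vnorm2 (ws ! i) \<noteq> 0" if "i < n" for i
  proof
    assume "vnorm2 (ws ! i) = 0"
    then have "ws ! i \<bullet>c ws ! i = 0" by (simp flip: complex_vnorm2_power2)
    then show False using corthogonalD[OF ws(2), of i i] that ws(3) by simp
  qed
  define s where "s i = complex_of_real (1 / vnorm2 (ws ! i))" for i
  define W where "W = mat_of_cols n (map (\<lambda>i. s i \<cdot>\<^sub>v ws ! i) [0..<n])"
  have W: "W \<in> carrier_mat n n" by (auto simp: W_def intro!: carrier_matI)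
  have colW: "col W i = s i \<cdot>\<^sub>v ws ! i" if "i < n" for i
    unfolding W_def using that wsc by simp
  have "mat_adjoint W * W = 1\<^sub>m n"
  proof (rule eq_matI)
    fix i j assume "i < dim_row (1\<^sub>m n :: complex mat)" "j < dim_col (1\<^sub>m n :: complex mat)"
    then have ij: "i < n" "j < n" by auto
    have "(mat_adjoint W * W) $$ (i, j) = col W j \<bullet>c col W i"
      using ij W by (auto simp: scalar_prod_def mult.commute intro!: sum.cong)
    also have "\<dots> = s j * cnj (s i) * (ws ! j \<bullet>c ws ! i)"
      using ij wsc[OF ij(1)] wsc[OF ij(2)]
      by (simp add: colW conjugate_smult_vec smult_scalar_prod_distrib[of _ n] scalar_prod_smult_distrib[of _ n])
    also have "\<dots> = 1\<^sub>m n $$ (i, j)"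
    proof (cases "i = j")
      case True
      have "s j * cnj (s j) * (ws ! j \<bullet>c ws ! j) = 1"
        using wn0[OF ij(2)] by (simp add: s_def power2_eq_square flip: complex_vnorm2_power2)
      then show ?thesis using True ij by simp
    next
      case False
      then have "ws ! j \<bullet>c ws ! i = 0" using corthogonalD[OF ws(2), of j i] ij ws(3) by auto
      then show ?thesis using False ij by simp
    qed
    finally show "(mat_adjoint W * W) $$ (i, j) = 1\<^sub>m n $$ (i, j)" .
  qed (use W in auto)
  moreover have "col W 0 = s 0 \<cdot>\<^sub>v v" using n0 by (simp add: colW ws0)
  ultimately show ?thesis using that W by blast
qed

lemma unitary_mult_adjoint:
  fixes U :: "complex mat"
  assumes "U \<in> carrier_mat n n" "mat_adjoint U * U = 1\<^sub>m n"
  shows "U * mat_adjoint U = 1\<^sub>m n"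
  using assms mat_mult_left_right_inverse[of "mat_adjoint U" n U] by simp

lemma unitary_mult:
  fixes U V :: "complex mat"
  assumes U: "U \<in> carrier_mat n n" "mat_adjoint U * U = 1\<^sub>m n"
    and V: "V \<in> carrier_mat n n" "mat_adjoint V * V = 1\<^sub>m n"
  shows "mat_adjoint (U * V) * (U * V) = 1\<^sub>m n"
proof -
  have "mat_adjoint (U * V) * (U * V) = mat_adjoint V * (mat_adjoint U * (U * V))"
    using U V by (simp add: mat_adjoint_mult[of U n n _ n] assoc_mult_mat[of _ n n _ n _ n])
  also have "mat_adjoint U * (U * V) = V"
    using U V by (intro mult_mat_left_cancel_inverse) auto
  finally show ?thesis using V by simp
qed

lemma normal_mat_unitary_conj:
  assumes A: "A \<in> carrier_mat n n" "normal_mat A"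
    and W: "W \<in> carrier_mat n n" "mat_adjoint W * W = 1\<^sub>m n"
  shows "normal_mat (mat_adjoint W * A * W)"
proof -
  have WW: "W * mat_adjoint W = 1\<^sub>m n" using unitary_mult_adjoint[OF W] .
  have conj_mult: "(mat_adjoint W * X * W) * (mat_adjoint W * Y * W) = mat_adjoint W * (X * Y) * W"
    if "X \<in> carrier_mat n n" "Y \<in> carrier_mat n n" for X Y
  proof -
    have "W * (mat_adjoint W * (Y * W)) = Y * W"
      using that W WW by (intro mult_mat_left_cancel_inverse[of _ _ n]) auto
    then show ?thesis using that W by (simp add: assoc_mult_mat[of _ n n _ n _ n])
  qed
  have adj: "mat_adjoint (mat_adjoint W * A * W) = mat_adjoint W * mat_adjoint A * W"
    using A W by (simp add: mat_adjoint_mult[of _ n n _ n] assoc_mult_mat[of _ n n _ n _ n])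
  show ?thesis
    using A unfolding normal_mat_def adj by (simp add: conj_mult)
qed

text \<open>The deflation step for normal matrices. Comparing the corner entries of
  \<open>A * mat_adjoint A\<close> and \<open>mat_adjoint A * A\<close> shows that row 0 and column
  0 have equal Euclidean norms; as column 0 has only its corner entry, so has row 0.\<close>

lemma normal_mat_four_block:
  fixes a :: complex
  assumes A: "A \<in> carrier_mat (Suc n) (Suc n)" "normal_mat A"
    and col0: "col A 0 = a \<cdot>\<^sub>v unit_vec (Suc n) 0"
  obtains B where "B \<in> carrier_mat n n" "normal_mat B"
    "A = four_block_mat (mat 1 1 (\<lambda>_. a)) (0\<^sub>m 1 n) (0\<^sub>m n 1) B"
proof -
  have A0: "A $$ (i, 0) = (if i = 0 then a else 0)" if "i < Suc n" for i
    using arg_cong[OF col0, of "\<lambda>v. v $ i"] A that by auto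
  have "(A * mat_adjoint A) $$ (0, 0) = (mat_adjoint A * A) $$ (0, 0)"
    using A by (simp add: normal_mat_def)
  moreover have "(A * mat_adjoint A) $$ (0, 0) =
      complex_of_real (\<Sum>j<Suc n. (cmod (A $$ (0, j)))\<^sup>2)"
    unfolding of_real_sum complex_norm_square using A
    by (auto simp: scalar_prod_def atLeast0LessThan intro!: sum.cong)
  moreover have "(mat_adjoint A * A) $$ (0, 0) = complex_of_real (\<Sum>j<Suc n. (cmod (A $$ (j, 0)))\<^sup>2)"
    unfolding of_real_sum complex_norm_square using A
    by (auto simp: scalar_prod_def atLeast0LessThan mult.commute intro!: sum.cong)
  ultimately have "(\<Sum>j<Suc n. (cmod (A $$ (0, j)))\<^sup>2) = (\<Sum>j<Suc n. (cmod (A $$ (j, 0)))\<^sup>2)"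
    by (simp only: of_real_eq_iff)
  also have "\<dots> = (cmod a)\<^sup>2" by (simp add: A0 sum.lessThan_Suc_shift del: sum.lessThan_Suc)
  \<comment> \<open>The summand at index 0 is itself the squared modulus of \<open>a\<close> and
    cancels.\<close>
  finally have "(\<Sum>j<n. (cmod (A $$ (0, Suc j)))\<^sup>2) = 0" by (simp add: A0 sum.lessThan_Suc_shift del: sum.lessThan_Suc)
  then have A0': "A $$ (0, Suc j) = 0" if "j < n" for j
    using that by (simp add: sum_nonneg_eq_0_iff)
  define B where "B = mat n n (\<lambda>(i, j). A $$ (Suc i, Suc j))"
  have AB: "A = four_block_mat (mat 1 1 (\<lambda>_. a)) (0\<^sub>m 1 n) (0\<^sub>m n 1) B"
    using A by (intro eq_matI) (auto simp: B_def A0 A0' less_Suc_eq_0_disj)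
  \<comment> \<open>Since the border of \<open>A\<close> vanishes, the lower right blocks of the two
    products of \<open>A\<close> with its adjoint are the corresponding products for
    \<open>B\<close>.\<close>
  have "normal_mat B"
    unfolding normal_mat_def
  proof (rule eq_matI)
    fix i j assume "i < dim_row (mat_adjoint B * B)" "j < dim_col (mat_adjoint B * B)"
    then have ij: "i < n" "j < n" by (auto simp: B_def)
    have "(A * mat_adjoint A) $$ (Suc i, Suc j) = (mat_adjoint A * A) $$ (Suc i, Suc j)"
      using A by (simp add: normal_mat_def)
    moreover have "(A * mat_adjoint A) $$ (Suc i, Suc j) = (B * mat_adjoint B) $$ (i, j)"
      using A ij by (simp add: scalar_prod_def A0 A0' B_def sum.atLeast0_lessThan_Suc_shift del: sum.op_ivl_Suc)
    moreover have "(mat_adjoint A * A) $$ (Suc i, Suc j) = (mat_adjoint B * B) $$ (i, j)"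
      using A ij by (simp add: scalar_prod_def A0 A0' B_def sum.atLeast0_lessThan_Suc_shift del: sum.op_ivl_Suc)
    ultimately show "(B * mat_adjoint B) $$ (i, j) = (mat_adjoint B * B) $$ (i, j)" by simp
  qed (auto simp: B_def)
  moreover have "B \<in> carrier_mat n n" by (simp add: B_def)
  ultimately show ?thesis using that AB by blast
qed

text \<open>Induction on the list of eigenvalues: rotate an eigenvector for the head into the first
  coordinate, split off a 1 by 1 block, and diagonalise the rest. Prescribing the list
  \<open>es\<close> fixes the diagonal, so that it can later be matched with the given enumeration
  of roots.\<close>

theorem normal_mat_unitary_diagonalization:
  assumes "A \<in> carrier_mat n n" "normal_mat A" "char_poly A = (\<Prod>a\<leftarrow>es. [:- a, 1:])"
  obtains U where "U \<in> carrier_mat n n" "mat_adjoint U * U = 1\<^sub>m n"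
    "A = U * mat n n (\<lambda>(i, j). if i = j then es ! i else 0) * mat_adjoint U"
proof -
  have "\<exists>U \<in> carrier_mat n n. mat_adjoint U * U = 1\<^sub>m n \<and>
      A = U * mat n n (\<lambda>(i, j). if i = j then es ! i else 0) * mat_adjoint U"
    using assms
  proof (induction es arbitrary: n A)
    case Nil
    then have "n = 0" using degree_monic_char_poly[of A n] by simp
    then show ?case using Nil by (intro bexI[of _ "1\<^sub>m 0"]) (auto intro!: eq_matI)
  next
    case (Cons e es)
    note A = Cons.prems(1)
    have "degree (\<Prod>a\<leftarrow>e # es. [:- a, 1:]) \<noteq> 0"
    proof -
      have "(\<Prod>a\<leftarrow>es. [:- a, 1:]) \<noteq> 0" by (auto simp: prod_list_zero_iff)
      then show ?thesis by (simp add: degree_mult_eq del: mult_pCons_left)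
    qed
    then obtain m where n: "n = Suc m"
      using degree_monic_char_poly[OF A] Cons.prems(3) by (cases n) auto
    have "eigenvalue A e" unfolding eigenvalue_root_char_poly[OF A] Cons.prems(3) by simp
    then obtain v where v: "v \<in> carrier_vec n" "v \<noteq> 0\<^sub>v n" "A *\<^sub>v v = e \<cdot>\<^sub>v v"
      using A unfolding eigenvalue_def eigenvector_def by auto
    obtain W a where W: "W \<in> carrier_mat n n" "mat_adjoint W * W = 1\<^sub>m n" "col W 0 = a \<cdot>\<^sub>v v"
      using exists_unitary_first_column[OF v(1,2)] by blast
    have WW: "W * mat_adjoint W = 1\<^sub>m n" using unitary_mult_adjoint[OF W(1,2)] .
    define A' where "A' = mat_adjoint W * A * W"
    have A': "A' \<in> carrier_mat n n" using A W by (simp add: A'_def)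
    have A_eq: "A = W * A' * mat_adjoint W"
    proof -
      have "W * (mat_adjoint W * X) = X" if "X \<in> carrier_mat n n" for X
        using that W WW by (intro mult_mat_left_cancel_inverse) auto
      then show ?thesis
        unfolding A'_def using A W WW by (simp add: assoc_mult_mat[of _ n n _ n _ n])
    qed
    \<comment> \<open>The vector \<open>a \<cdot>\<^sub>v v\<close> is replaced by
      \<open>W *\<^sub>v unit_vec n 0\<close> again after \<open>A\<close> has acted, so the scalar
      \<open>a\<close> never has to be divided out.\<close>
    have "col A' 0 = mat_adjoint W *\<^sub>v (A *\<^sub>v (W *\<^sub>v unit_vec n 0))"
      using A W(1) n A' by (simp add: A'_def col_eq_mult_unit_vec assoc_mult_mat_vec[of _ n n _ n])
    also have "W *\<^sub>v unit_vec n 0 = a \<cdot>\<^sub>v v" using W n col_eq_mult_unit_vec[of 0 W] by simp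
    also have "A *\<^sub>v \<dots> = e \<cdot>\<^sub>v (a \<cdot>\<^sub>v v)"
      using A v by (simp add: mult_mat_vec[of _ n n] smult_smult_assoc mult.commute)
    also have "a \<cdot>\<^sub>v v = W *\<^sub>v unit_vec n 0" using W n col_eq_mult_unit_vec[of 0 W] by simp
    also have "mat_adjoint W *\<^sub>v (e \<cdot>\<^sub>v (W *\<^sub>v unit_vec n 0)) =
        e \<cdot>\<^sub>v (mat_adjoint W * W *\<^sub>v unit_vec n 0)"
      using W(1) by (simp add: mult_mat_vec[of _ n n] assoc_mult_mat_vec[of _ n n _ n])
    finally have "col A' 0 = e \<cdot>\<^sub>v unit_vec (Suc m) 0" using W(2) n by simp
    moreover have "normal_mat A'"
      unfolding A'_def using normal_mat_unitary_conj A Cons.prems(2) W by blast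
    ultimately obtain B where B: "B \<in> carrier_mat m m" "normal_mat B"
      "A' = four_block_mat (mat 1 1 (\<lambda>_. e)) (0\<^sub>m 1 m) (0\<^sub>m m 1) B"
      using normal_mat_four_block[of A' m e] A' n by blast
    \<comment> \<open>Similarity preserves the characteristic polynomial, so cancelling the linear
      factor of \<open>e\<close> leaves the product over \<open>es\<close> for \<open>B\<close>, as
      the induction hypothesis requires.\<close>
    have "similar_mat A A'"
      by (rule similar_matI[of _ _ W "mat_adjoint W" n]) (use A A' W WW A_eq in auto)
    then have "char_poly A' = char_poly A" using char_poly_similar by metis
    moreover have "char_poly A' = char_poly (mat 1 1 (\<lambda>_. e)) * char_poly B"
      unfolding B(3) by (rule char_poly_four_block_zeros_col) (use B in auto)
    moreover have "char_poly (mat 1 1 (\<lambda>_. e)) = [:- e, 1:]"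
      by (simp add: char_poly_defs det_def sign_def)
    ultimately have "[:- e, 1:] * char_poly B = [:- e, 1:] * (\<Prod>a\<leftarrow>es. [:- a, 1:])"
      using Cons.prems(3) by simp
    then have "char_poly B = (\<Prod>a\<leftarrow>es. [:- a, 1:])" by (subst (asm) mult_cancel_left) simp
    from Cons.IH[OF B(1,2) this] obtain V where V: "V \<in> carrier_mat m m"
      "mat_adjoint V * V = 1\<^sub>m m"
      "B = V * mat m m (\<lambda>(i, j). if i = j then es ! i else 0) * mat_adjoint V" by blast
    \<comment> \<open>The unitary matrix for the smaller block is extended by 1 in the corner, which
      leaves the eigenvalue already split off untouched.\<close>
    define V' where "V' = four_block_mat (1\<^sub>m 1) (0\<^sub>m 1 m) (0\<^sub>m m 1) V"
    have V': "V' \<in> carrier_mat n n" using V n by (auto simp: V'_def intro!: carrier_matI)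
    have adjV': "mat_adjoint V' = four_block_mat (1\<^sub>m 1) (0\<^sub>m 1 m) (0\<^sub>m m 1) (mat_adjoint V)"
      using V by (intro eq_matI) (auto simp: V'_def)
    have V'V': "mat_adjoint V' * V' = 1\<^sub>m n"
      unfolding adjV' unfolding V'_def using V n
      by (subst mult_four_block_mat[of _ 1 1 _ m _ m _ _ 1 _ m]) auto
    let ?D = "mat n n (\<lambda>(i, j). if i = j then (e # es) ! i else 0)"
    let ?D' = "mat m m (\<lambda>(i, j). if i = j then es ! i else 0)"
    have D: "?D = four_block_mat (mat 1 1 (\<lambda>_. e)) (0\<^sub>m 1 m) (0\<^sub>m m 1) ?D'"
      using n by (intro eq_matI) (auto simp: nth_Cons')
    have "V' * ?D * mat_adjoint V' = A'"
      unfolding adjV' D unfolding V'_def B(3) using V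
      by (subst mult_four_block_mat[of _ 1 1 _ m _ m _ _ 1 _ m], auto)
        (subst mult_four_block_mat[of _ 1 1 _ m _ m _ _ 1 _ m], auto)
    then have "A = W * (V' * ?D * mat_adjoint V') * mat_adjoint W" using A_eq by simp
    also have "\<dots> = (W * V') * ?D * mat_adjoint (W * V')"
      using W V' by (simp add: mat_adjoint_mult[of _ n n _ n] assoc_mult_mat[of _ n n _ n _ n])
    finally show ?case
      using W V' unitary_mult[OF W(1,2) V' V'V'] by (intro bexI[of _ "W * V'"]) auto
  qed
  then show ?thesis using that by blast
qed

section \<open>Determinant expansions\<close>

text \<open>Adding a factor turns the remainder \<open>\<rho>\<close> into
  \<open>(1 + f j) * \<rho> + f j * ?S\<close>, where the new product is of second order. The square
  of the cardinality works as a constant because \<open>k\<^sup>2 + k \<le> (k + 1)\<^sup>2\<close>.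
  The ceiling \<open>b\<close> on \<open>y\<close> keeps the constant independent of
  \<open>y\<close>.\<close>

lemma norm_prod_one_plus_le:
  fixes f :: "'a \<Rightarrow> complex"
  assumes "finite I" "\<And>i. i \<in> I \<Longrightarrow> cmod (f i) \<le> y" "y \<le> b" "0 \<le> y"
  shows "cmod ((\<Prod>i\<in>I. 1 + f i) - 1 - (\<Sum>i\<in>I. f i)) \<le> of_nat (card I) ^ 2 * (1 + b) ^ card I * y\<^sup>2"
  using assms(1,2)
proof (induction I rule: finite_induct)
  case (insert j I)
  let ?P = "\<Prod>i\<in>I. 1 + f i" and ?S = "\<Sum>i\<in>I. f i" and ?k = "card I"
  define \<rho> where "\<rho> = ?P - 1 - ?S"
  have b: "0 \<le> b" using assms by simp
  have f: "cmod (f i) \<le> y" if "i \<in> insert j I" for i using insert.prems that .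
  have \<rho>: "cmod \<rho> \<le> of_nat ?k ^ 2 * (1 + b) ^ ?k * y\<^sup>2"
    unfolding \<rho>_def using insert.IH f by blast
  have "cmod ?S \<le> of_nat ?k * y" using f by (intro sum_norm_bound) auto
  then have fS: "cmod (f j * ?S) \<le> of_nat ?k * y\<^sup>2"
    unfolding norm_mult power2_eq_square using mult_mono[OF f[of j]] assms(4)
    by (simp add: mult.left_commute)
  have "1 \<le> (1 + b) ^ Suc ?k" using b by (intro one_le_power) simp
  then have k: "of_nat ?k * y\<^sup>2 \<le> of_nat ?k * (1 + b) ^ Suc ?k * y\<^sup>2"
    by (intro mult_right_mono) (auto simp: mult_le_cancel_left1)
  have "cmod (1 + f j) \<le> 1 + b"
    using norm_triangle_ineq[of 1 "f j"] f[of j] assms(3) by simp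
  then have "cmod ((1 + f j) * \<rho>) \<le> (1 + b) * (of_nat ?k ^ 2 * (1 + b) ^ ?k * y\<^sup>2)"
    unfolding norm_mult using \<rho> b by (intro mult_mono) auto
  then have "cmod ((1 + f j) * \<rho> + f j * ?S) \<le>
      (1 + b) * (of_nat ?k ^ 2 * (1 + b) ^ ?k * y\<^sup>2) + of_nat ?k * (1 + b) ^ Suc ?k * y\<^sup>2"
    using norm_triangle_ineq[of "(1 + f j) * \<rho>" "f j * ?S"] fS k by linarith
  also have "\<dots> = (of_nat ?k ^ 2 + of_nat ?k) * ((1 + b) ^ Suc ?k * y\<^sup>2)"
    by (simp add: algebra_simps)
  also have "\<dots> \<le> of_nat (Suc ?k) ^ 2 * ((1 + b) ^ Suc ?k * y\<^sup>2)"
  proof (rule mult_right_mono)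
    show "of_nat ?k ^ 2 + of_nat ?k \<le> (of_nat (Suc ?k) ^ 2 :: real)"
      by (simp add: power2_eq_square algebra_simps)
  qed (use b in simp)
  also have "(1 + f j) * \<rho> + f j * ?S = (\<Prod>i\<in>insert j I. 1 + f i) - 1 - (\<Sum>i\<in>insert j I. f i)"
    using insert.hyps by (simp add: \<rho>_def algebra_simps)
  finally show ?case using insert.hyps by (simp add: mult.assoc)
qed simp

lemma abs_sign [simp]: "\<bar>real_of_int (sign p)\<bar> = 1"
  by (simp add: sign_def)

text \<open>A crude bound, used only to see that perturbed determinants stay bounded when the
  perturbations are not small.\<close>

lemma cmod_det_le:
  assumes "A \<in> carrier_mat n n" "\<And>i j. i < n \<Longrightarrow> j < n \<Longrightarrow> cmod (A $$ (i, j)) \<le> k"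
  shows "cmod (det A) \<le> fact n * k ^ n"
proof -
  have "cmod (det A) \<le> (\<Sum>p | p permutes {0..<n}. k ^ n)"
    unfolding det_def'[OF assms(1)]
  proof (rule sum_norm_le)
    fix p assume "p \<in> {p. p permutes {0..<n}}"
    then have p: "p i < n" if "i < n" for i using that permutes_in_image[of p "{0..<n}" i] by auto
    have "cmod (signof p * (\<Prod>i=0..<n. A $$ (i, p i))) = (\<Prod>i=0..<n. cmod (A $$ (i, p i)))"
      by (simp add: norm_mult flip: prod_norm)
    also have "\<dots> \<le> (\<Prod>i=0..<n. k)" using assms(2) p by (intro prod_mono) auto
    finally show "cmod (signof p * (\<Prod>i=0..<n. A $$ (i, p i))) \<le> k ^ n" by simp
  qed
  then show ?thesis by (simp add: card_permutations)
qed

text \<open>In the Leibniz formula the identity permutation gives the product of the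
  \<open>1 + Y $$ (i, i)\<close>, whose linear part is the trace. Every other permutation moves at
  least two points and so contributes two off-diagonal entries, hence a factor
  \<open>y\<^sup>2\<close>.\<close>

lemma cmod_det_one_plus_le:
  assumes Y: "Y \<in> carrier_mat n n" and y: "\<And>i j. i < n \<Longrightarrow> j < n \<Longrightarrow> cmod (Y $$ (i, j)) \<le> y"
    and b: "0 \<le> y" "y \<le> b"
  shows "cmod (det (1\<^sub>m n + Y) - 1 - (\<Sum>i<n. Y $$ (i, i))) \<le>
    (real n ^ 2 + fact n) * (1 + b) ^ n * y\<^sup>2"
proof -
  let ?Perm = "{p. p permutes {0..<n}}"
  let ?t = "\<lambda>p. signof p * (\<Prod>i=0..<n. (1\<^sub>m n + Y) $$ (i, p i))"
  have fin: "finite ?Perm" by (simp add: finite_permutations)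
  have "det (1\<^sub>m n + Y) = (\<Sum>p\<in>?Perm. ?t p)" using Y by (intro det_def') auto
  also have "\<dots> = ?t id + (\<Sum>p\<in>?Perm - {id}. ?t p)"
    using fin by (intro sum.remove) (auto simp: permutes_id)
  also have "?t id = (\<Prod>i<n. 1 + Y $$ (i, i))"
    using Y by (auto simp: atLeast0LessThan intro!: prod.cong)
  finally have det: "det (1\<^sub>m n + Y) = (\<Prod>i<n. 1 + Y $$ (i, i)) + (\<Sum>p\<in>?Perm - {id}. ?t p)" .
  have "cmod (\<Sum>p\<in>?Perm - {id}. ?t p) \<le> real (card (?Perm - {id})) * ((1 + b) ^ n * y\<^sup>2)"
  proof (rule sum_norm_bound)
    fix p assume "p \<in> ?Perm - {id}"
    then have p: "p permutes {0..<n}" "p \<noteq> id" by auto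
    then obtain i where pi: "p i \<noteq> i" by (auto simp: fun_eq_iff)
    have i: "i \<in> {0..<n}" using p(1) pi by (metis permutes_not_in)
    then have pn: "p j < n" if "j < n" for j using that permutes_in_image[OF p(1), of j] by auto
    \<comment> \<open>By injectivity the image of a moved point is moved as well; \<open>i\<close>
      and \<open>p i\<close> are the two rows with off-diagonal factors.\<close>
    have ppi: "p (p i) \<noteq> p i" using pi permutes_inj[OF p(1)] by (auto dest: injD)
    define J where "J = {0..<n} - {i, p i}"
    have I: "{0..<n} = insert i (insert (p i) J)" using i pn by (auto simp: J_def)
    have J: "finite J" "i \<notin> insert (p i) J" "p i \<notin> J" using pi by (auto simp: J_def)
    have "cmod (?t p) = (\<Prod>j\<in>{0..<n}. cmod ((1\<^sub>m n + Y) $$ (j, p j)))"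
      by (simp add: norm_mult flip: prod_norm)
    also have "\<dots> = cmod (Y $$ (i, p i)) * cmod (Y $$ (p i, p (p i))) * (\<Prod>j\<in>J. cmod ((1\<^sub>m n + Y) $$ (j, p j)))"
      unfolding I using J Y i pn pi ppi by (simp add: mult.assoc)
    also have "\<dots> \<le> y * y * (\<Prod>j\<in>J. 1 + b)"
    proof (intro mult_mono prod_mono conjI prod_nonneg mult_nonneg_nonneg)
      fix j assume "j \<in> J"
      then have j: "j < n" by (simp add: J_def)
      have "cmod ((1\<^sub>m n + Y) $$ (j, p j)) \<le> cmod (1\<^sub>m n $$ (j, p j)) + cmod (Y $$ (j, p j))"
        using Y j pn by (simp add: norm_triangle_ineq)
      also have "\<dots> \<le> 1 + b" using j pn y[of j "p j"] b by (intro add_mono) auto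
      finally show "cmod ((1\<^sub>m n + Y) $$ (j, p j)) \<le> 1 + b" .
    qed (use y pn i b in auto)
    also have "\<dots> = y * y * (1 + b) ^ card J" by simp
    also have "\<dots> \<le> y * y * (1 + b) ^ n"
    proof (intro mult_left_mono power_increasing)
      show "card J \<le> n" using card_mono[of "{0..<n}" J] by (simp add: J_def)
    qed (use b in auto)
    finally show "cmod (?t p) \<le> (1 + b) ^ n * y\<^sup>2"
      by (simp add: power2_eq_square mult.commute)
  qed
  also have "\<dots> \<le> fact n * ((1 + b) ^ n * y\<^sup>2)"
  proof (rule mult_right_mono)
    have "card ?Perm = fact n" by (rule card_permutations) auto
    then have "card (?Perm - {id}) \<le> fact n" using card_Diff1_le[of ?Perm id] by simp
    then show "real (card (?Perm - {id})) \<le> fact n" by (metis of_nat_fact of_nat_le_iff)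
  qed (use b in simp)
  finally have "cmod (\<Sum>p\<in>?Perm - {id}. ?t p) \<le> fact n * ((1 + b) ^ n * y\<^sup>2)" .
  moreover have "cmod ((\<Prod>i<n. 1 + Y $$ (i, i)) - 1 - (\<Sum>i<n. Y $$ (i, i))) \<le> real n ^ 2 * (1 + b) ^ n * y\<^sup>2"
    using norm_prod_one_plus_le[of "{..<n}" "\<lambda>i. Y $$ (i, i)" y b] y b by simp
  ultimately have "cmod (((\<Prod>i<n. 1 + Y $$ (i, i)) - 1 - (\<Sum>i<n. Y $$ (i, i))) + (\<Sum>p\<in>?Perm - {id}. ?t p)) \<le>
      real n ^ 2 * (1 + b) ^ n * y\<^sup>2 + fact n * ((1 + b) ^ n * y\<^sup>2)"
    by (rule norm_triangle_mono[rotated])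
  then show ?thesis unfolding det by (simp add: algebra_simps)
qed

section \<open>Rank-one matrices and the matrix determinant lemma\<close>

lemma index_outer [simp]:
  assumes "i < dim_vec u" "j < dim_vec v"
  shows "outer u v $$ (i, j) = u $ i * v $ j"
  using assms by (simp add: outer_def)

lemma dim_outer [simp]: "dim_row (outer u v) = dim_vec u" "dim_col (outer u v) = dim_vec v"
  by (simp_all add: outer_def)

lemma outer_carrier [simp]: "u \<in> carrier_vec m \<Longrightarrow> v \<in> carrier_vec n \<Longrightarrow> outer u v \<in> carrier_mat m n"
  by (auto simp: outer_def)

lemma mult_outer:
  assumes "A \<in> carrier_mat m n" "u \<in> carrier_vec n"
  shows "A * outer u v = outer (A *\<^sub>v u) v"
  by (rule eq_matI) (use assms in \<open>auto simp: scalar_prod_def sum_distrib_right mult.assoc\<close>)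

text \<open>The block identity \<open>?L * ?M = ?N * ?L\<close> conjugates one block upper
  triangular matrix into another. Since \<open>?L\<close> has determinant 1, the determinants of
  \<open>?M\<close> and \<open>?N\<close> agree, and these are the two sides.\<close>

lemma det_one_plus_outer:
  assumes u: "u \<in> carrier_vec n" and v: "v \<in> carrier_vec n"
  shows "det (1\<^sub>m n + outer u v) = 1 + v \<bullet> u"
proof -
  let ?u = "mat n 1 (\<lambda>(i, j). u $ i)" and ?v = "mat 1 n (\<lambda>(i, j). v $ j)"
  let ?one = "1\<^sub>m 1 :: complex mat" and ?I = "1\<^sub>m n :: complex mat"
  let ?s = "mat 1 1 (\<lambda>_. 1 + v \<bullet> u)"
  let ?L = "four_block_mat ?I (0\<^sub>m n 1) ?v ?one"
  let ?M = "four_block_mat (?I + outer u v) ?u (0\<^sub>m 1 n) ?one"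
  let ?N = "four_block_mat ?I ?u (0\<^sub>m 1 n) ?s"
  have uv: "?u * ?v = outer u v"
    using u v by (intro eq_matI) (auto simp: scalar_prod_def)
  have vu: "?v * ?u + ?one = ?s"
    using u v by (intro eq_matI) (auto simp: scalar_prod_def)
  have "?v * (?I + outer u v) = ?s * ?v"
  proof -
    have "?v * (?I + outer u v) = ?v * ?I + ?v * (?u * ?v)"
      unfolding uv using u v by (intro mult_add_distrib_mat) auto
    also have "?v * (?u * ?v) = (?v * ?u) * ?v" by (intro assoc_mult_mat[symmetric]) auto
    also have "?v * ?I = ?one * ?v" by simp
    also have "?one * ?v + (?v * ?u) * ?v = (?v * ?u + ?one) * ?v"
      by (subst add_mult_distrib_mat[of _ 1 1]) (auto intro!: comm_add_mat)
    finally show ?thesis unfolding vu .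
  qed
  then have "?L * ?M = ?N * ?L"
    using u v uv vu
    by (subst mult_four_block_mat[of _ n n _ 1 _ 1 _ _ n _ 1], auto)
      (subst mult_four_block_mat[of _ n n _ 1 _ 1 _ _ n _ 1], auto)
  then have "det (?L * ?M) = det (?N * ?L)" by simp
  moreover have "det (?L * ?M) = det ?L * det ?M" "det (?N * ?L) = det ?N * det ?L"
    using u v by (auto intro!: det_mult[of _ "n + 1"])
  moreover have "det ?L = 1" by (subst det_four_block_mat_upper_right_zero[of _ n _ 1]) auto
  moreover have "det ?M = det (?I + outer u v)"
    using u v by (subst det_four_block_mat_lower_left_zero[of _ n _ 1]) auto
  moreover have "det ?N = 1 + v \<bullet> u"
    by (subst det_four_block_mat_lower_left_zero[of _ n _ 1]) (auto simp: det_single)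
  ultimately show ?thesis by simp
qed

text \<open>Writing the left vector as \<open>X *\<^sub>v z\<close> asks for a solution of a linear
  system in place of an inverse of \<open>X\<close>.\<close>

lemma det_add_outer:
  assumes "X \<in> carrier_mat n n" "z \<in> carrier_vec n" "w \<in> carrier_vec n"
  shows "det (X + outer (X *\<^sub>v z) w) = det X * (1 + w \<bullet> z)"
proof -
  have "X + outer (X *\<^sub>v z) w = X * (1\<^sub>m n + outer z w)"
    using assms by (subst mult_add_distrib_mat[of _ n n]) (auto simp: mult_outer[of X n n])
  then show ?thesis
    using assms det_mult[of X n "1\<^sub>m n + outer z w"] by (simp add: det_one_plus_outer)
qed

section \<open>Confederate matrices\<close>

lemma dim_Phi [simp]: "dim_vec (Phi n \<phi> x) = n" "Phi n \<phi> x \<in> carrier_vec n"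
  by (simp_all add: Phi_def)

lemma degree_gradedD:
  assumes "degree_graded n \<phi>" "j \<le> n"
  shows "degree (cpoly (\<phi> j)) = j" "lead_coeff (\<phi> j) \<noteq> 0"
    "lead_coeff (cpoly (\<phi> j)) = complex_of_real (lead_coeff (\<phi> j))"
proof -
  have j: "degree (\<phi> j) = j" "lead_coeff (\<phi> j) \<noteq> 0" using assms unfolding degree_graded_def by blast+
  then show "degree (cpoly (\<phi> j)) = j" by (simp add: degree_map_poly)
  then show "lead_coeff (cpoly (\<phi> j)) = complex_of_real (lead_coeff (\<phi> j))"
    using j by (simp add: coeff_map_poly)
  show "lead_coeff (\<phi> j) \<noteq> 0" by fact
qed

lemma poly_char_poly:
  fixes A :: "complex mat"
  assumes "A \<in> carrier_mat n n"
  shows "poly (char_poly A) x = det (x \<cdot>\<^sub>m 1\<^sub>m n - A)"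
  unfolding char_poly_def
  by (rule poly_det_cong[of _ n]) (use assms in \<open>auto simp: char_poly_matrix_def\<close>)

text \<open>The confederate identity is lifted to the polynomial ring as
  \<open>K *\<^sub>v P = q \<cdot>\<^sub>v unit_vec n 0\<close>, with \<open>K\<close> the
  characteristic matrix. Multiplying by the adjugate makes \<open>q\<close> divide each entry of
  \<open>det K \<cdot>\<^sub>v P\<close>, and one entry of \<open>P\<close> is a nonzero
  constant.\<close>

lemma confederate_dvd_char_poly:
  assumes "n \<ge> 1" and \<phi>: "degree_graded n \<phi>" and H: "confederate n \<phi> H"
  shows "cpoly (\<phi> n) dvd char_poly H"
proof -
  have Hc: "H \<in> carrier_mat n n"
    and HP: "H *\<^sub>v Phi n \<phi> x = x \<cdot>\<^sub>v Phi n \<phi> x -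
      (inverse (chi n \<phi>) * poly (cpoly (\<phi> n)) x) \<cdot>\<^sub>v unit_vec n 0" for x
    using H by (auto simp: confederate_def)
  define K where "K = char_poly_matrix H"
  define P where "P = vec n (\<lambda>i. cpoly (\<phi> (n - 1 - i)))"
  define q where "q = smult (inverse (chi n \<phi>)) (cpoly (\<phi> n))"
  have K: "K \<in> carrier_mat n n" and P: "P \<in> carrier_vec n" using Hc by (auto simp: K_def P_def)
  have "K *\<^sub>v P = q \<cdot>\<^sub>v unit_vec n 0"
  proof (rule eq_vecI)
    fix i assume "i < dim_vec (q \<cdot>\<^sub>v unit_vec n 0)"
    then have i: "i < n" by simp
    have "poly ((K *\<^sub>v P) $ i) x = poly ((q \<cdot>\<^sub>v unit_vec n 0) $ i) x" for x
    proof -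
      have "poly ((K *\<^sub>v P) $ i) x = (\<Sum>j<n. poly (K $$ (i, j)) x * Phi n \<phi> x $ j)"
        using i K P by (simp add: scalar_prod_def poly_sum P_def Phi_def atLeast0LessThan)
      also have "\<dots> = (\<Sum>j<n. (if j = i then x * Phi n \<phi> x $ j else 0) - H $$ (i, j) * Phi n \<phi> x $ j)"
        using i Hc by (intro sum.cong) (auto simp: K_def char_poly_matrix_def algebra_simps)
      also have "\<dots> = x * Phi n \<phi> x $ i - (H *\<^sub>v Phi n \<phi> x) $ i"
        using i Hc by (simp add: sum_subtractf scalar_prod_def atLeast0LessThan)
      also have "\<dots> = poly ((q \<cdot>\<^sub>v unit_vec n 0) $ i) x"
        unfolding HP using i by (simp add: q_def)
      finally show ?thesis .
    qed
    \<comment> \<open>Polynomials over the complex numbers that agree at every point are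
      equal.\<close>
    then show "(K *\<^sub>v P) $ i = (q \<cdot>\<^sub>v unit_vec n 0) $ i"
      by (intro poly_eq_poly_eq_iff[THEN iffD1] ext)
  qed (use K in simp)
  note KP = this
  have "adj_mat K *\<^sub>v (K *\<^sub>v P) = adj_mat K * K *\<^sub>v P"
    using adj_mat(1)[OF K] K P by (intro assoc_mult_mat_vec[symmetric]) auto
  also have "\<dots> = det K \<cdot>\<^sub>v P"
    unfolding adj_mat(3)[OF K] using P by (intro eq_vecI) auto
  \<comment> \<open>Row \<open>n - 1\<close> is the one where \<open>P\<close> has the constant
    entry \<open>cpoly (\<phi> 0)\<close>.\<close>
  finally have "(adj_mat K *\<^sub>v (q \<cdot>\<^sub>v unit_vec n 0)) $ (n - 1) = (det K \<cdot>\<^sub>v P) $ (n - 1)"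
    unfolding KP by simp
  moreover have "(adj_mat K *\<^sub>v (q \<cdot>\<^sub>v unit_vec n 0)) $ (n - 1) = q * adj_mat K $$ (n - 1, 0)"
    using adj_mat(1)[OF K] assms(1) by simp
  moreover have "(det K \<cdot>\<^sub>v P) $ (n - 1) = char_poly H * cpoly (\<phi> 0)"
    using assms(1) by (simp add: P_def K_def char_poly_def)
  ultimately have "char_poly H * cpoly (\<phi> 0) = q * adj_mat K $$ (n - 1, 0)" by simp
  moreover have "cpoly (\<phi> n) dvd q * adj_mat K $$ (n - 1, 0)"
    unfolding q_def by (intro dvd_mult2 dvd_smult) simp
  ultimately have dvd: "cpoly (\<phi> n) dvd char_poly H * cpoly (\<phi> 0)" by simp
  obtain a where a: "cpoly (\<phi> 0) = [:a:]" "a \<noteq> 0"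
    using degree_gradedD[OF \<phi>, of 0] by (metis degree_eq_zeroE coeff_pCons_0 of_real_eq_0_iff le0)
  have "char_poly H * [:a:] = smult a (char_poly H)" by simp
  with dvd a show ?thesis by (simp add: dvd_smult_iff)
qed

text \<open>Both polynomials have degree n, so the quotient is constant; the leading coefficients
  determine it.\<close>

lemma confederate_char_poly:
  assumes "n \<ge> 1" and \<phi>: "degree_graded n \<phi>" and H: "confederate n \<phi> H"
  shows "cpoly (\<phi> n) = smult (complex_of_real (lead_coeff (\<phi> n))) (char_poly H)"
proof -
  note \<phi>n = degree_gradedD[OF \<phi> order_refl]
  have cp: "degree (char_poly H) = n" "monic (char_poly H)"
    using degree_monic_char_poly[of H n] H by (auto simp: confederate_def)
  obtain k where k: "char_poly H = cpoly (\<phi> n) * k"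
    using confederate_dvd_char_poly[OF assms] by (elim dvdE)
  then have "cpoly (\<phi> n) \<noteq> 0" "k \<noteq> 0" using cp(2) by auto
  then have "degree k = 0" using k cp(1) \<phi>n(1) by (simp add: degree_mult_eq)
  then obtain b where b: "k = [:b:]" by (elim degree_eq_zeroE)
  then have cpb: "char_poly H = smult b (cpoly (\<phi> n))" using k by simp
  then have "b * complex_of_real (lead_coeff (\<phi> n)) = 1"
    using cp(2) \<phi>n(3) unfolding cpb lead_coeff_smult by simp
  then show ?thesis unfolding cpb by (simp add: mult.commute)
qed

section \<open>The resolvent of a normal matrix\<close>

lemma vnorm2_diagonal_mult_le:
  assumes "v \<in> carrier_vec n" "\<And>i. i < n \<Longrightarrow> cmod (f i) \<le> k" "0 \<le> k"
  shows "vnorm2 (mat n n (\<lambda>(i, j). if i = j then f i else 0) *\<^sub>v v) \<le> k * vnorm2 v"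
proof -
  have "(mat n n (\<lambda>(i, j). if i = j then f i else 0) *\<^sub>v v) $ i = f i * v $ i" if "i < n" for i
    using that assms(1) by (simp add: scalar_prod_def if_distrib[of "\<lambda>x. x * _"] cong: if_cong)
  then have "vnorm2 (mat n n (\<lambda>(i, j). if i = j then f i else 0) *\<^sub>v v) \<le>
      L2_set (\<lambda>i. k * cmod (v $ i)) {..<n}"
    unfolding vnorm2_def using assms by (auto intro!: L2_set_mono mult_right_mono simp: norm_mult)
  also have "\<dots> = k * vnorm2 v"
    using assms by (simp add: vnorm2_def L2_set_right_distrib)
  finally show ?thesis .
qed

lemma mnorm2_unitary_conj_le:
  assumes U: "U \<in> carrier_mat n n" "mat_adjoint U * U = 1\<^sub>m n" and E: "E \<in> carrier_mat n n"
  shows "mnorm2 (mat_adjoint U * E * U) \<le> mnorm2 E"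
proof (rule mnorm2_le[OF mnorm2_nonneg])
  fix v :: "complex vec" assume "v \<in> carrier_vec (dim_col (mat_adjoint U * E * U))"
  then have v: "v \<in> carrier_vec n" using U by simp
  have "vnorm2 (mat_adjoint U * E * U *\<^sub>v v) = vnorm2 (mat_adjoint U *\<^sub>v (E *\<^sub>v (U *\<^sub>v v)))"
    using U E v by (simp add: assoc_mult_mat_vec[of _ n n _ n] mult_mat_vec_carrier[of _ n n])
  also have "\<dots> = vnorm2 (E *\<^sub>v (U *\<^sub>v v))"
    using U E v unitary_mult_adjoint[OF U] by (intro vnorm2_unitary[of _ n]) auto
  also have "\<dots> \<le> mnorm2 E * vnorm2 (U *\<^sub>v v)"
    using U E v by (intro vnorm2_mult_le) auto
  also have "vnorm2 (U *\<^sub>v v) = vnorm2 v" using U v by (intro vnorm2_unitary)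
  finally show "vnorm2 (mat_adjoint U * E * U *\<^sub>v v) \<le> mnorm2 E * vnorm2 v" .
qed

lemma M_max_ge: "j \<in> {1..n} \<Longrightarrow> 1 / cmod (\<xi> - r j) \<le> M_max n r \<xi>"
  unfolding M_max_def by (intro Max_ge) auto

lemma M_max_nonneg:
  assumes "n \<ge> 1"
  shows "0 \<le> M_max n r \<xi>"
proof -
  have "0 \<le> 1 / cmod (\<xi> - r 1)" by simp
  also have "\<dots> \<le> M_max n r \<xi>" using assms by (intro M_max_ge) simp
  finally show ?thesis .
qed

lemma S_sum_nonneg: "0 \<le> S_sum n r \<xi>"
  by (simp add: S_sum_def sum_nonneg)

text \<open>Here \<open>\<tau>\<close> is the trace of \<open>B * E\<close>, computed in the
  eigenbasis: each diagonal entry of the rotated perturbation is at most \<open>mnorm2 E\<close> and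
  is divided by its own \<open>\<xi> - r j\<close>, which produces \<open>S_sum\<close>. Only its
  bound is exported, as later steps need nothing else.\<close>

theorem normal_mat_resolvent:
  assumes n: "n \<ge> 1" and H: "H \<in> carrier_mat n n" "normal_mat H"
    and cp: "char_poly H = (\<Prod>j=1..n. [:- r j, 1:])"
    and \<xi>: "\<And>j. j \<in> {1..n} \<Longrightarrow> \<xi> \<noteq> r j"
    and A: "A = \<xi> \<cdot>\<^sub>m 1\<^sub>m n - H"
  obtains B K where "B \<in> carrier_mat n n" "B * A = 1\<^sub>m n" "A * B = 1\<^sub>m n"
    "\<And>v. v \<in> carrier_vec n \<Longrightarrow> vnorm2 (B *\<^sub>v v) \<le> M_max n r \<xi> * vnorm2 v" "0 \<le> K"
    "\<And>E. E \<in> carrier_mat n n \<Longrightarrow> mnorm2 E \<le> 1 \<Longrightarrow> \<exists>\<tau>. cmod \<tau> \<le> S_sum n r \<xi> * mnorm2 E \<and>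
       cmod (det (A + E) - det A * (1 + \<tau>)) \<le> K * (mnorm2 E)\<^sup>2"
proof -
  let ?M = "M_max n r \<xi>"
  define es where "es = map r [1..<Suc n]"
  \<comment> \<open>Lists and matrices count from 0 but the roots from 1, so diagonal position
    \<open>i\<close> carries \<open>r (Suc i)\<close>.\<close>
  have es: "es ! i = r (Suc i)" if "i < n" for i using that by (simp add: es_def del: upt_Suc)
  have "(\<Prod>a\<leftarrow>es. [:- a, 1:]) = (\<Prod>j=1..n. [:- r j, 1:])"
    unfolding es_def by (simp add: prod.distinct_set_conv_list[symmetric] o_def atLeastLessThanSuc_atLeastAtMost del: upt_Suc)
  then obtain U where U: "U \<in> carrier_mat n n" "mat_adjoint U * U = 1\<^sub>m n"
    and HU: "H = U * mat n n (\<lambda>(i, j). if i = j then es ! i else 0) * mat_adjoint U"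
    using normal_mat_unitary_diagonalization[OF H, of es] cp by auto
  note UU = unitary_mult_adjoint[OF U]
  have U': "mat_adjoint U \<in> carrier_mat n n" using U by simp
  define D where "D = mat n n (\<lambda>(i, j). if i = j then \<xi> - r (Suc i) else 0)"
  define D' where "D' = mat n n (\<lambda>(i, j). if i = j then 1 / (\<xi> - r (Suc i)) else 0)"
  have D: "D \<in> carrier_mat n n" "D' \<in> carrier_mat n n" by (auto simp: D_def D'_def)
  have d: "\<xi> - r (Suc i) \<noteq> 0" if "i < n" for i using \<xi>[of "Suc i"] that by simp
  have DD': "D * D' = 1\<^sub>m n" "D' * D = 1\<^sub>m n"
    using d by (auto intro!: eq_matI sum.neutral simp: D_def D'_def scalar_prod_def
        if_distrib[of "\<lambda>x. x * _"] cong: if_cong)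
  have UcancelL: "mat_adjoint U * (U * X) = X" and UcancelR: "U * (mat_adjoint U * X) = X"
    if "X \<in> carrier_mat n n" for X
    using that U UU by (auto intro!: mult_mat_left_cancel_inverse[of _ _ n])
  have assoc: "X * Y * Z = X * (Y * Z)"
    if "X \<in> carrier_mat n n" "Y \<in> carrier_mat n n" "Z \<in> carrier_mat n n" for X Y Z :: "complex mat"
    using that by (rule assoc_mult_mat)
  have AU: "A = U * D * mat_adjoint U"
  proof -
    let ?L = "mat n n (\<lambda>(i, j). if i = j then es ! i else 0)"
    have DL: "D = \<xi> \<cdot>\<^sub>m 1\<^sub>m n - ?L" by (intro eq_matI) (auto simp: D_def es)
    have "U * D = U * (\<xi> \<cdot>\<^sub>m 1\<^sub>m n) - U * ?L"
      unfolding DL using U by (intro mult_minus_distrib_mat) auto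
    also have "\<dots> * mat_adjoint U = U * (\<xi> \<cdot>\<^sub>m 1\<^sub>m n) * mat_adjoint U - U * ?L * mat_adjoint U"
      using U by (intro minus_mult_distrib_mat) auto
    also have "U * (\<xi> \<cdot>\<^sub>m 1\<^sub>m n) * mat_adjoint U = \<xi> \<cdot>\<^sub>m 1\<^sub>m n"
      using U UU by (simp add: mult_smult_distrib[of _ n n _ n] mult_smult_assoc_mat[of _ n n _ n])
    finally show ?thesis using HU A by simp
  qed
  define B where "B = U * D' * mat_adjoint U"
  have Ac: "A \<in> carrier_mat n n" using AU U D by simp
  have B: "B \<in> carrier_mat n n" using U D by (simp add: B_def)
  have BA: "B * A = 1\<^sub>m n"
  proof -
    have "B * A = U * (D' * (mat_adjoint U * (U * (D * mat_adjoint U))))"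
      unfolding B_def AU using U D U' by (simp add: assoc)
    also have "mat_adjoint U * (U * (D * mat_adjoint U)) = D * mat_adjoint U"
      using U' D by (intro UcancelL) simp
    also have "D' * (D * mat_adjoint U) = mat_adjoint U"
      using D U' DD' by (intro mult_mat_left_cancel_inverse[of _ _ n]) auto
    finally show ?thesis using UU by simp
  qed
  then have AB: "A * B = 1\<^sub>m n" using mat_mult_left_right_inverse[OF B Ac] by simp
  have M0: "0 \<le> ?M" using M_max_nonneg[OF n] .
  have dM: "cmod (1 / (\<xi> - r (Suc i))) \<le> ?M" if "i < n" for i
    using that M_max_ge[of "Suc i" n \<xi> r] by (simp add: norm_divide)
  have Bnorm: "vnorm2 (B *\<^sub>v v) \<le> ?M * vnorm2 v" if v: "v \<in> carrier_vec n" for v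
  proof -
    have "vnorm2 (B *\<^sub>v v) = vnorm2 (U *\<^sub>v (D' *\<^sub>v (mat_adjoint U *\<^sub>v v)))"
      unfolding B_def using U U' D v by (simp add: assoc_mult_mat_vec[of _ n n _ n] mult_mat_vec_carrier[of _ n n])
    also have "\<dots> = vnorm2 (D' *\<^sub>v (mat_adjoint U *\<^sub>v v))"
      using U U' D v by (intro vnorm2_unitary[of _ n]) (auto simp: mult_mat_vec_carrier[of _ n n])
    also have "\<dots> \<le> ?M * vnorm2 (mat_adjoint U *\<^sub>v v)"
      unfolding D'_def using U' v dM M0 by (intro vnorm2_diagonal_mult_le) auto
    also have "vnorm2 (mat_adjoint U *\<^sub>v v) = vnorm2 v"
      using U' UU v by (intro vnorm2_unitary) auto
    finally show ?thesis .
  qed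
  have detUU: "det U * det (mat_adjoint U) = 1"
    using det_mult[OF U(1) U'] UU by simp
  have det_conj: "det (U * X * mat_adjoint U) = det X" if "X \<in> carrier_mat n n" for X
  proof -
    have "det (U * X * mat_adjoint U) = det U * det X * det (mat_adjoint U)"
      using det_mult[OF _ U', of "U * X"] det_mult[OF U(1) that] U that by simp
    also have "\<dots> = det X * (det U * det (mat_adjoint U))" by (simp add: mult_ac)
    finally show ?thesis unfolding detUU by simp
  qed
  \<comment> \<open>This is the constant of \<open>cmod_det_one_plus_le\<close> for
    \<open>y = ?M * mnorm2 E\<close>, with ceiling \<open>b = ?M\<close> because
    \<open>mnorm2 E \<le> 1\<close>; \<open>?M\<^sup>2\<close> comes from squaring
    \<open>y\<close>.\<close>
  define K where "K = cmod (det A) * ((real n ^ 2 + fact n) * (1 + ?M) ^ n * ?M\<^sup>2)"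
  have K0: "0 \<le> K" using M0 by (auto simp: K_def)
  have expansion: "\<exists>\<tau>. cmod \<tau> \<le> S_sum n r \<xi> * mnorm2 E \<and>
      cmod (det (A + E) - det A * (1 + \<tau>)) \<le> K * (mnorm2 E)\<^sup>2"
    if E: "E \<in> carrier_mat n n" and E1: "mnorm2 E \<le> 1" for E
  proof -
    define G where "G = mat_adjoint U * E * U"
    have G: "G \<in> carrier_mat n n" using E U U' by (simp add: G_def)
    have Gij: "cmod (G $$ (i, j)) \<le> mnorm2 E" if "i < n" "j < n" for i j
    proof -
      have "cmod (G $$ (i, j)) \<le> mnorm2 G" using that G by (intro cmod_index_le_mnorm2) auto
      also have "\<dots> \<le> mnorm2 E" unfolding G_def by (rule mnorm2_unitary_conj_le[OF U E])
      finally show ?thesis .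
    qed
    \<comment> \<open>Pulling \<open>D\<close> out of \<open>D + G\<close> leaves the determinant of
      \<open>1 + Y\<close>, where row \<open>i\<close> of \<open>Y\<close> is row \<open>i\<close>
      of \<open>G\<close> divided by \<open>\<xi> - r (Suc i)\<close>.\<close>
    define Y where "Y = D' * G"
    have Y: "Y \<in> carrier_mat n n" using D G by (simp add: Y_def)
    have Yij: "Y $$ (i, j) = G $$ (i, j) / (\<xi> - r (Suc i))" if "i < n" "j < n" for i j
      using that G D unfolding Y_def
      by (simp add: D'_def scalar_prod_def if_distrib[of "\<lambda>x. x * _"] cong: if_cong)
    have AE: "A + E = U * (D * (1\<^sub>m n + Y)) * mat_adjoint U"
    proof -
      have "D * (1\<^sub>m n + Y) = D * 1\<^sub>m n + D * Y" using D Y by (intro mult_add_distrib_mat) auto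
      also have "D * Y = G"
        unfolding Y_def using DD' D G by (intro mult_mat_left_cancel_inverse[of _ _ n]) auto
      finally have "U * (D * (1\<^sub>m n + Y)) = U * D + U * G"
        using U D G by (simp add: mult_add_distrib_mat[of _ n n])
      also have "\<dots> * mat_adjoint U = U * D * mat_adjoint U + U * G * mat_adjoint U"
        using U U' D G by (intro add_mult_distrib_mat) auto
      also have "U * G * mat_adjoint U = E"
        unfolding G_def using U U' E UU by (simp add: assoc UcancelR)
      finally show ?thesis using AU by simp
    qed
    have "det (A + E) = det D * det (1\<^sub>m n + Y)"
      unfolding AE using D Y det_conj[of "D * (1\<^sub>m n + Y)"] det_mult[OF D(1), of "1\<^sub>m n + Y"] by simp
    also have "det D = det A" unfolding AU using det_conj[OF D(1)] by simp
    finally have det: "det (A + E) = det A * det (1\<^sub>m n + Y)" .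
    define \<tau> where "\<tau> = (\<Sum>i<n. Y $$ (i, i))"
    have "cmod \<tau> \<le> (\<Sum>i<n. 1 / cmod (\<xi> - r (Suc i)) * mnorm2 E)"
      unfolding \<tau>_def by (intro sum_norm_le) (auto simp: Yij norm_divide Gij divide_right_mono)
    also have "\<dots> = S_sum n r \<xi> * mnorm2 E"
      unfolding S_sum_def sum_distrib_right
      by (rule sum.reindex_bij_witness[of _ "\<lambda>j. j - 1" Suc]) auto
    finally have \<tau>: "cmod \<tau> \<le> S_sum n r \<xi> * mnorm2 E" .
    have "cmod (Y $$ (i, j)) \<le> ?M * mnorm2 E" if "i < n" "j < n" for i j
    proof -
      have "cmod (Y $$ (i, j)) = cmod (1 / (\<xi> - r (Suc i))) * cmod (G $$ (i, j))"
        using that by (simp add: Yij norm_divide)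
      also have "\<dots> \<le> ?M * mnorm2 E" using dM Gij that M0 by (intro mult_mono) auto
      finally show ?thesis .
    qed
    then have "cmod (det (1\<^sub>m n + Y) - 1 - \<tau>) \<le> (real n ^ 2 + fact n) * (1 + ?M) ^ n * (?M * mnorm2 E)\<^sup>2"
      unfolding \<tau>_def using Y M0 E1 mnorm2_nonneg[of E]
      by (intro cmod_det_one_plus_le) (auto simp: mult_left_le)
    then have "cmod (det A) * cmod (det (1\<^sub>m n + Y) - 1 - \<tau>) \<le> K * (mnorm2 E)\<^sup>2"
      unfolding K_def power_mult_distrib by (simp add: mult_left_mono mult.assoc)
    also have "cmod (det A) * cmod (det (1\<^sub>m n + Y) - 1 - \<tau>) = cmod (det (A + E) - det A * (1 + \<tau>))"
      unfolding det norm_mult[symmetric] by (simp add: algebra_simps)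
    finally show ?thesis using \<tau> by blast
  qed
  show ?thesis using that[OF B BA AB Bnorm K0 expansion] by blast
qed

section \<open>First-order perturbation of the determinant\<close>

text \<open>The condition \<open>M * s \<le> 1 / 2\<close> makes \<open>B * E\<close> a contraction
  by one half, which excludes a kernel of \<open>A + E\<close> and bounds the solution. In the
  equation for \<open>y\<close> the first two terms are of first order; the last one is of second
  order once \<open>y\<close> is known to be of order \<open>s\<close>.\<close>

lemma exists_perturbed_solution:
  assumes A: "A \<in> carrier_mat n n" and B: "B \<in> carrier_mat n n" and BA: "B * A = 1\<^sub>m n"
    and M: "0 \<le> M" "\<And>v. v \<in> carrier_vec n \<Longrightarrow> vnorm2 (B *\<^sub>v v) \<le> M * vnorm2 v"
    and E: "E \<in> carrier_mat n n" and e: "e \<in> carrier_vec n" and f: "f \<in> carrier_vec n"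
    and s: "mnorm2 E \<le> s" "vnorm2 f \<le> s" "M * s \<le> 1 / 2" "s \<le> 1"
  obtains y where "y \<in> carrier_vec n" "(A + E) *\<^sub>v (B *\<^sub>v e + y) = e + f"
    "y = B *\<^sub>v f - B *\<^sub>v (E *\<^sub>v (B *\<^sub>v e)) - B *\<^sub>v (E *\<^sub>v y)"
    "vnorm2 y \<le> M * (1 + 2 * M * (vnorm2 e + 1)) * s"
proof -
  note mc = mult_mat_vec_carrier[of _ n n]
  have s0: "0 \<le> s" using s(1) mnorm2_nonneg[of E] by linarith
  have BE: "vnorm2 (B *\<^sub>v (E *\<^sub>v v)) \<le> M * s * vnorm2 v" if v: "v \<in> carrier_vec n" for v
  proof -
    have "vnorm2 (B *\<^sub>v (E *\<^sub>v v)) \<le> M * vnorm2 (E *\<^sub>v v)" using E v by (intro M) simp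
    also have "\<dots> \<le> M * (s * vnorm2 v)"
      using vnorm2_mult_le[of v E] E v s(1) M(1)
      by (intro mult_left_mono order_trans[OF vnorm2_mult_le] mult_right_mono) auto
    finally show ?thesis by (simp add: mult.assoc)
  qed
  have BX: "B *\<^sub>v ((A + E) *\<^sub>v v) = v + B *\<^sub>v (E *\<^sub>v v)" if v: "v \<in> carrier_vec n" for v
  proof -
    have "B *\<^sub>v ((A + E) *\<^sub>v v) = B *\<^sub>v (A *\<^sub>v v) + B *\<^sub>v (E *\<^sub>v v)"
      using A B E v by (simp add: add_mult_distrib_mat_vec[of _ n n] mult_add_distrib_mat_vec[of _ n n] mc)
    also have "B *\<^sub>v (A *\<^sub>v v) = v" using A B BA v by (simp flip: assoc_mult_mat_vec)
    finally show ?thesis .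
  qed
  have X: "A + E \<in> carrier_mat n n" using A E by simp
  have "det (A + E) \<noteq> 0"
  proof
    assume "det (A + E) = 0"
    then obtain v where v: "v \<in> carrier_vec n" "v \<noteq> 0\<^sub>v n" "(A + E) *\<^sub>v v = 0\<^sub>v n"
      using det_0_iff_vec_prod_zero[OF X] by blast
    have "B *\<^sub>v 0\<^sub>v n = 0\<^sub>v n" using B by (intro eq_vecI) (auto intro!: scalar_prod_right_zero row_carrier)
    then have "0\<^sub>v n = v + B *\<^sub>v (E *\<^sub>v v)" using BX[OF v(1)] v(3) by simp
    then have "v = - (B *\<^sub>v (E *\<^sub>v v))"
      using B E v(1) by (auto simp: vec_eq_iff eq_neg_iff_add_eq_0)
    then have "vnorm2 v = vnorm2 (B *\<^sub>v (E *\<^sub>v v))" by (metis vnorm2_uminus)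
    also have "\<dots> \<le> M * s * vnorm2 v" using BE[OF v(1)] .
    also have "\<dots> \<le> 1 / 2 * vnorm2 v" using s by (intro mult_right_mono) auto
    finally have "vnorm2 v = 0" using vnorm2_nonneg[of v] by linarith
    then show False using v by (simp add: vnorm2_eq_0_iff)
  qed
  then obtain X' where X': "X' \<in> carrier_mat n n" "(A + E) * X' = 1\<^sub>m n"
    using det_non_zero_imp_unit[OF X] unfolding Units_def ring_mat_def by auto
  define z where "z = X' *\<^sub>v (e + f)"
  have z: "z \<in> carrier_vec n" using X' e f by (simp add: z_def)
  have Xz: "(A + E) *\<^sub>v z = e + f"
    unfolding z_def using X X' e f by (simp flip: assoc_mult_mat_vec)
  have Bz: "z + B *\<^sub>v (E *\<^sub>v z) = B *\<^sub>v e + B *\<^sub>v f"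
    using BX[OF z] B e f by (simp add: Xz mult_add_distrib_mat_vec[of _ n n])
  define y where "y = z - B *\<^sub>v e"
  have y: "y \<in> carrier_vec n" using z B e by (simp add: y_def)
  have zy: "z = B *\<^sub>v e + y" using z B e by (auto simp: y_def)
  have yz: "y = B *\<^sub>v f - B *\<^sub>v (E *\<^sub>v z)"
  proof (rule eq_vecI)
    fix i assume i: "i < dim_vec (B *\<^sub>v f - B *\<^sub>v (E *\<^sub>v z))"
    then show "y $ i = (B *\<^sub>v f - B *\<^sub>v (E *\<^sub>v z)) $ i"
      using arg_cong[OF Bz, of "\<lambda>v. v $ i"] B E e f z by (simp add: y_def algebra_simps)
  qed (use B y in simp)
  have Ez: "B *\<^sub>v (E *\<^sub>v z) = B *\<^sub>v (E *\<^sub>v (B *\<^sub>v e)) + B *\<^sub>v (E *\<^sub>v y)"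
    unfolding zy using B E e y by (simp add: mult_add_distrib_mat_vec[of _ n n] mc)
  then have y_eq: "y = B *\<^sub>v f - B *\<^sub>v (E *\<^sub>v (B *\<^sub>v e)) - B *\<^sub>v (E *\<^sub>v y)"
    by (subst yz, subst Ez) (use B in \<open>auto simp: vec_eq_iff\<close>)
  have "z = B *\<^sub>v e + B *\<^sub>v f - B *\<^sub>v (E *\<^sub>v z)"
    using Bz[symmetric] B E z by (auto simp: vec_eq_iff)
  then have "vnorm2 z \<le> vnorm2 (B *\<^sub>v e) + vnorm2 (B *\<^sub>v f) + vnorm2 (B *\<^sub>v (E *\<^sub>v z))"
    using vnorm2_diff_le[of "B *\<^sub>v e + B *\<^sub>v f" "B *\<^sub>v (E *\<^sub>v z)"] vnorm2_add_le[of "B *\<^sub>v e" "B *\<^sub>v f"] B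
    by simp
  \<comment> \<open>The last summand is half of the left side and gets absorbed;
    \<open>s \<le> 1\<close> bounds the norm of \<open>f\<close> by 1.\<close>
  also have "\<dots> \<le> M * vnorm2 e + M * 1 + 1 / 2 * vnorm2 z"
  proof (intro add_mono)
    show "vnorm2 (B *\<^sub>v f) \<le> M * 1"
      using M(2)[OF f] mult_left_mono[of "vnorm2 f" 1 M] M(1) s by linarith
    show "vnorm2 (B *\<^sub>v (E *\<^sub>v z)) \<le> 1 / 2 * vnorm2 z"
      using BE[OF z] mult_right_mono[of "M * s" "1 / 2" "vnorm2 z"] s by simp
  qed (rule M(2)[OF e])
  finally have zn: "vnorm2 z \<le> 2 * M * (vnorm2 e + 1)" by (simp add: algebra_simps)
  \<comment> \<open>The bound on \<open>z\<close> is only of order one; inserted into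
    \<open>yz\<close> it makes \<open>y\<close> of order \<open>s\<close>.\<close>
  have "vnorm2 y \<le> vnorm2 (B *\<^sub>v f) + vnorm2 (B *\<^sub>v (E *\<^sub>v z))"
    unfolding yz using B by (intro vnorm2_diff_le) simp
  also have "\<dots> \<le> M * s + M * s * (2 * M * (vnorm2 e + 1))"
  proof (rule add_mono)
    show "vnorm2 (B *\<^sub>v f) \<le> M * s"
      using M(2)[OF f] mult_left_mono[of "vnorm2 f" s M] M(1) s by linarith
    show "vnorm2 (B *\<^sub>v (E *\<^sub>v z)) \<le> M * s * (2 * M * (vnorm2 e + 1))"
      using BE[OF z] mult_left_mono[OF zn, of "M * s"] M(1) s0 by simp
  qed
  finally have "vnorm2 y \<le> M * (1 + 2 * M * (vnorm2 e + 1)) * s" by (simp add: algebra_simps)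
  with that y Xz y_eq show ?thesis unfolding zy by blast
qed

text \<open>The separate bounds \<open>\<alpha>\<close>, \<open>\<beta>\<close>,
  \<open>\<gamma>\<close> keep the linear part sharp, while the remainder is measured by their
  common bound \<open>s\<close>. The constants \<open>L\<close> and \<open>s\<^sub>0\<close> are
  fixed before the perturbations, which gives uniformity.\<close>

lemma det_rank_one_perturbation_bound:
  assumes A: "A \<in> carrier_mat n n" and B: "B \<in> carrier_mat n n" and BA: "B * A = 1\<^sub>m n" and AB: "A * B = 1\<^sub>m n"
    and M: "0 \<le> M" "\<And>v. v \<in> carrier_vec n \<Longrightarrow> vnorm2 (B *\<^sub>v v) \<le> M * vnorm2 v"
    and S: "0 \<le> S" "0 \<le> K" "\<And>E. E \<in> carrier_mat n n \<Longrightarrow> mnorm2 E \<le> 1 \<Longrightarrow> \<exists>\<tau>. cmod \<tau> \<le> S * mnorm2 E \<and>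
       cmod (det (A + E) - det A * (1 + \<tau>)) \<le> K * (mnorm2 E)\<^sup>2"
    and e: "e \<in> carrier_vec n" and c: "c \<in> carrier_vec n"
  obtains L s\<^sub>0 where "0 \<le> L" "0 < s\<^sub>0"
    "\<And>E f g \<alpha> \<beta> \<gamma> s. E \<in> carrier_mat n n \<Longrightarrow> f \<in> carrier_vec n \<Longrightarrow> g \<in> carrier_vec n \<Longrightarrow>
      mnorm2 E \<le> \<alpha> \<Longrightarrow> vnorm2 f \<le> \<beta> \<Longrightarrow> vnorm2 g \<le> \<gamma> \<Longrightarrow> \<alpha> \<le> s \<Longrightarrow> \<beta> \<le> s \<Longrightarrow> \<gamma> \<le> s \<Longrightarrow> s \<le> s\<^sub>0 \<Longrightarrow>
      cmod (det (A + E + outer (e + f) (c + g)) - det (A + outer e c)) \<le>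
        cmod (det A) * (M * vnorm2 c * \<beta> + vnorm2 (B *\<^sub>v e) * \<gamma> +
          (S + vnorm2 (B *\<^sub>v e) * (M + S) * vnorm2 c) * \<alpha>) + L * s\<^sup>2"
proof -
  note mc = mult_mat_vec_carrier[of _ n n]
  let ?z = "B *\<^sub>v e"
  let ?c = "vnorm2 c" and ?\<zeta> = "vnorm2 ?z" and ?\<delta> = "det A"
  have z: "?z \<in> carrier_vec n" using B e by simp
  \<comment> \<open>\<open>Y * s\<close> bounds the correction \<open>y\<close> of the solution,
    \<open>Q * s\<close> bounds the change of \<open>c \<bullet> z\<close>, and \<open>L\<close>
    collects all terms that are at least quadratic. The choice of \<open>s\<^sub>0\<close> ensures
    both \<open>M * s \<le> 1 / 2\<close> and \<open>s \<le> 1\<close>, also when \<open>M\<close>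
    is 0.\<close>
  define Y where "Y = M * (1 + 2 * M * (vnorm2 e + 1))"
  define Q where "Q = ?\<zeta> + ?c * M + ?c * M * ?\<zeta> + Y + ?c * M * Y"
  define L where "L = cmod ?\<delta> * (S * Q + Y + ?c * M * Y) + K * (1 + ?c * ?\<zeta> + Q)"
  define s\<^sub>0 where "s\<^sub>0 = 1 / (2 * (M + 1))"
  have Y0: "0 \<le> Y" using M by (simp add: Y_def)
  have Q0: "0 \<le> Q" using Y0 M by (simp add: Q_def)
  have L0: "0 \<le> L" using Y0 Q0 M S by (simp add: L_def)
  have s\<^sub>0: "0 < s\<^sub>0" using M by (simp add: s\<^sub>0_def)
  have "cmod (det (A + E + outer (e + f) (c + g)) - det (A + outer e c)) \<le>
        cmod ?\<delta> * (M * ?c * \<beta> + ?\<zeta> * \<gamma> + (S + ?\<zeta> * (M + S) * ?c) * \<alpha>) + L * s\<^sup>2"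
    if E: "E \<in> carrier_mat n n" and f: "f \<in> carrier_vec n" and g: "g \<in> carrier_vec n"
      and \<alpha>: "mnorm2 E \<le> \<alpha>" and \<beta>: "vnorm2 f \<le> \<beta>" and \<gamma>: "vnorm2 g \<le> \<gamma>"
      and s: "\<alpha> \<le> s" "\<beta> \<le> s" "\<gamma> \<le> s" "s \<le> s\<^sub>0"
    for E f g \<alpha> \<beta> \<gamma> s
  proof -
    have nonneg: "0 \<le> \<alpha>" "0 \<le> \<beta>" "0 \<le> \<gamma>" "0 \<le> s"
      using \<alpha> \<beta> \<gamma> s mnorm2_nonneg[of E] vnorm2_nonneg[of f] vnorm2_nonneg[of g] by linarith+
    have "s\<^sub>0 \<le> 1" using M by (simp add: s\<^sub>0_def)
    then have s1: "s \<le> 1" using s by linarith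
    have "M * s \<le> M * s\<^sub>0" using s M by (intro mult_left_mono) auto
    also have "\<dots> \<le> 1 / 2" using M by (simp add: s\<^sub>0_def field_simps)
    finally have Ms: "M * s \<le> 1 / 2" .
    obtain y where y: "y \<in> carrier_vec n" "(A + E) *\<^sub>v (?z + y) = e + f"
      "y = B *\<^sub>v f - B *\<^sub>v (E *\<^sub>v ?z) - B *\<^sub>v (E *\<^sub>v y)" "vnorm2 y \<le> Y * s"
      unfolding Y_def
      by (rule exists_perturbed_solution[OF A B BA M E e f, of s]) (use \<alpha> \<beta> s s1 Ms in auto)
    obtain \<tau> where \<tau>: "cmod \<tau> \<le> S * mnorm2 E" "cmod (det (A + E) - ?\<delta> * (1 + \<tau>)) \<le> K * (mnorm2 E)\<^sup>2"
      using S(3)[OF E] \<alpha> s s1 by auto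
    define \<rho> where "\<rho> = det (A + E) - ?\<delta> * (1 + \<tau>)"
    \<comment> \<open>The bound by \<open>\<alpha>\<close> serves the linear term, the coarser one
      by \<open>s\<close> the remainder.\<close>
    have \<tau>\<alpha>: "cmod \<tau> \<le> S * \<alpha>" using \<tau>(1) mult_left_mono[OF \<alpha> S(1)] by linarith
    also have "\<dots> \<le> S * s" using s S by (intro mult_left_mono)
    finally have \<tau>s: "cmod \<tau> \<le> S * s" .
    have "(mnorm2 E)\<^sup>2 \<le> s\<^sup>2" using \<alpha> s mnorm2_nonneg[of E] by (intro power_mono) auto
    then have \<rho>s: "cmod \<rho> \<le> K * s\<^sup>2"
      using \<tau>(2) mult_left_mono[OF _ S(2), of "(mnorm2 E)\<^sup>2" "s\<^sup>2"] unfolding \<rho>_def by linarith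
    \<comment> \<open>The scalar product is split by order: \<open>q\<^sub>0\<close> is unperturbed,
      \<open>q\<^sub>1\<close> linear and \<open>q\<^sub>2\<close> quadratic in the
      perturbations.\<close>
    define q\<^sub>0 where "q\<^sub>0 = c \<bullet> ?z"
    define q\<^sub>1 where "q\<^sub>1 = g \<bullet> ?z + c \<bullet> (B *\<^sub>v f) - c \<bullet> (B *\<^sub>v (E *\<^sub>v ?z))"
    define q\<^sub>2 where "q\<^sub>2 = g \<bullet> y - c \<bullet> (B *\<^sub>v (E *\<^sub>v y))"
    have q: "(c + g) \<bullet> (?z + y) = q\<^sub>0 + q\<^sub>1 + q\<^sub>2"
    proof -
      have "c \<bullet> y = c \<bullet> (B *\<^sub>v f) - c \<bullet> (B *\<^sub>v (E *\<^sub>v ?z)) - c \<bullet> (B *\<^sub>v (E *\<^sub>v y))"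
      proof -
        have "c \<bullet> y = c \<bullet> (B *\<^sub>v f - B *\<^sub>v (E *\<^sub>v ?z) - B *\<^sub>v (E *\<^sub>v y))" using y(3) by (rule arg_cong)
        also have "\<dots> = c \<bullet> (B *\<^sub>v f) - c \<bullet> (B *\<^sub>v (E *\<^sub>v ?z)) - c \<bullet> (B *\<^sub>v (E *\<^sub>v y))"
          using B E c f y(1) z by (simp add: scalar_prod_minus_distrib[of _ n] mc)
        finally show ?thesis .
      qed
      moreover have "(c + g) \<bullet> (?z + y) = c \<bullet> ?z + g \<bullet> ?z + (c \<bullet> y + g \<bullet> y)"
        using c g z y(1) by (simp add: add_scalar_prod_distrib[of _ n] scalar_prod_add_distrib[of _ n])
      ultimately show ?thesis by (simp add: q\<^sub>0_def q\<^sub>1_def q\<^sub>2_def)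
    qed
    have q\<^sub>0: "cmod q\<^sub>0 \<le> ?c * ?\<zeta>" unfolding q\<^sub>0_def using c B by (intro cmod_scalar_prod_le) auto
    have cB: "cmod (c \<bullet> (B *\<^sub>v v)) \<le> ?c * M * k" if "v \<in> carrier_vec n" "vnorm2 v \<le> k" for v k
    proof -
      have "cmod (c \<bullet> (B *\<^sub>v v)) \<le> ?c * vnorm2 (B *\<^sub>v v)" using c B by (intro cmod_scalar_prod_le) auto
      also have "\<dots> \<le> ?c * (M * k)"
        using M(2)[OF that(1)] mult_left_mono[OF that(2) M(1)] by (intro mult_left_mono) auto
      finally show ?thesis by (simp add: mult.assoc)
    qed
    have Ev: "vnorm2 (E *\<^sub>v v) \<le> \<alpha> * k" if "v \<in> carrier_vec n" "vnorm2 v \<le> k" for v k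
      using vnorm2_mult_le[of v E] that E mult_mono[OF \<alpha> that(2) nonneg(1) vnorm2_nonneg] by simp
    have gv: "cmod (g \<bullet> v) \<le> \<gamma> * k" if "v \<in> carrier_vec n" "vnorm2 v \<le> k" for v k
      using cmod_scalar_prod_le[of g v] that g mult_mono[OF \<gamma> that(2) nonneg(3) vnorm2_nonneg] by simp
    have "cmod q\<^sub>1 \<le> cmod (g \<bullet> ?z) + cmod (c \<bullet> (B *\<^sub>v f)) + cmod (c \<bullet> (B *\<^sub>v (E *\<^sub>v ?z)))"
      unfolding q\<^sub>1_def using norm_triangle_ineq4[of "g \<bullet> ?z + c \<bullet> (B *\<^sub>v f)" "c \<bullet> (B *\<^sub>v (E *\<^sub>v ?z))"]
        norm_triangle_ineq[of "g \<bullet> ?z" "c \<bullet> (B *\<^sub>v f)"] by linarith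
    also have "\<dots> \<le> \<gamma> * ?\<zeta> + ?c * M * \<beta> + ?c * M * (\<alpha> * ?\<zeta>)"
      using E f z \<beta> by (intro add_mono gv cB Ev) (auto simp: mc)
    finally have q\<^sub>1: "cmod q\<^sub>1 \<le> \<gamma> * ?\<zeta> + ?c * M * \<beta> + ?c * M * (\<alpha> * ?\<zeta>)" .
    also have "\<dots> \<le> s * ?\<zeta> + ?c * M * s + ?c * M * (s * ?\<zeta>)"
      using s M nonneg by (intro add_mono mult_left_mono mult_right_mono) auto
    finally have q\<^sub>1s: "cmod q\<^sub>1 \<le> (?\<zeta> + ?c * M + ?c * M * ?\<zeta>) * s" by (simp add: algebra_simps)
    have "cmod q\<^sub>2 \<le> cmod (g \<bullet> y) + cmod (c \<bullet> (B *\<^sub>v (E *\<^sub>v y)))"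
      unfolding q\<^sub>2_def by (rule norm_triangle_ineq4)
    also have "\<dots> \<le> \<gamma> * (Y * s) + ?c * M * (\<alpha> * (Y * s))"
      using E y(1,4) by (intro add_mono gv cB Ev) (auto simp: mc)
    also have "\<dots> \<le> s * (Y * s) + ?c * M * (s * (Y * s))"
      using s M nonneg Y0 by (intro add_mono mult_left_mono mult_right_mono) auto
    finally have q\<^sub>2: "cmod q\<^sub>2 \<le> (Y + ?c * M * Y) * s\<^sup>2" by (simp add: algebra_simps power2_eq_square)
    also have "\<dots> \<le> (Y + ?c * M * Y) * s"
      using s1 nonneg Y0 M by (intro mult_left_mono) (auto simp: power2_eq_square mult_left_le)
    finally have "cmod q\<^sub>2 \<le> (Y + ?c * M * Y) * s" .
    then have q\<^sub>1\<^sub>2: "cmod (q\<^sub>1 + q\<^sub>2) \<le> Q * s"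
      using q\<^sub>1s norm_triangle_ineq[of q\<^sub>1 q\<^sub>2] by (simp add: Q_def algebra_simps)
    also have "\<dots> \<le> Q" using s1 Q0 by (simp add: mult_left_le)
    finally have q\<^sub>1\<^sub>2': "cmod (q\<^sub>1 + q\<^sub>2) \<le> Q" .
    have "det (A + E + outer (e + f) (c + g)) = det (A + E) * (1 + (c + g) \<bullet> (?z + y))"
      using det_add_outer[of "A + E" n "?z + y" "c + g"] A E z y c g by simp
    then have 1: "det (A + E + outer (e + f) (c + g)) = (?\<delta> * (1 + \<tau>) + \<rho>) * (1 + (q\<^sub>0 + q\<^sub>1 + q\<^sub>2))"
      unfolding q by (simp add: \<rho>_def)
    have "A *\<^sub>v ?z = e" using A B AB e by (simp flip: assoc_mult_mat_vec)
    then have 2: "det (A + outer e c) = ?\<delta> * (1 + q\<^sub>0)"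
      using det_add_outer[of A n ?z c] A z c by (simp add: q\<^sub>0_def)
    \<comment> \<open>The first two summands are the linear part; in the parenthesis every term
      contains \<open>q\<^sub>2\<close>, \<open>\<rho>\<close> or a product of two small
      quantities.\<close>
    have "det (A + E + outer (e + f) (c + g)) - det (A + outer e c) =
        ?\<delta> * (\<tau> * (1 + q\<^sub>0)) + ?\<delta> * q\<^sub>1 + (?\<delta> * (\<tau> * (q\<^sub>1 + q\<^sub>2) + q\<^sub>2) + \<rho> * (1 + q\<^sub>0 + (q\<^sub>1 + q\<^sub>2)))"
      unfolding 1 2 by (simp add: algebra_simps)
    also have "cmod \<dots> \<le> cmod ?\<delta> * (S * \<alpha> * (1 + ?c * ?\<zeta>)) +
        cmod ?\<delta> * (\<gamma> * ?\<zeta> + ?c * M * \<beta> + ?c * M * (\<alpha> * ?\<zeta>)) +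
        (cmod ?\<delta> * (S * s * (Q * s) + (Y + ?c * M * Y) * s\<^sup>2) + K * s\<^sup>2 * (1 + ?c * ?\<zeta> + Q))"
    proof (intro norm_triangle_mono)
      have one_q\<^sub>0: "cmod (1 + q\<^sub>0) \<le> 1 + ?c * ?\<zeta>" using norm_triangle_ineq[of 1 q\<^sub>0] q\<^sub>0 by simp
      then show "cmod (?\<delta> * (\<tau> * (1 + q\<^sub>0))) \<le> cmod ?\<delta> * (S * \<alpha> * (1 + ?c * ?\<zeta>))"
        unfolding norm_mult using \<tau>\<alpha> S nonneg by (intro mult_left_mono mult_mono) auto
      show "cmod (?\<delta> * q\<^sub>1) \<le> cmod ?\<delta> * (\<gamma> * ?\<zeta> + ?c * M * \<beta> + ?c * M * (\<alpha> * ?\<zeta>))"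
        unfolding norm_mult using q\<^sub>1 by (intro mult_left_mono) auto
      have "cmod (\<tau> * (q\<^sub>1 + q\<^sub>2)) \<le> S * s * (Q * s)"
        unfolding norm_mult using \<tau>s q\<^sub>1\<^sub>2 S nonneg by (intro mult_mono) auto
      then have "cmod (\<tau> * (q\<^sub>1 + q\<^sub>2) + q\<^sub>2) \<le> S * s * (Q * s) + (Y + ?c * M * Y) * s\<^sup>2"
        using q\<^sub>2 by (intro norm_triangle_mono)
      then show "cmod (?\<delta> * (\<tau> * (q\<^sub>1 + q\<^sub>2) + q\<^sub>2)) \<le> cmod ?\<delta> * (S * s * (Q * s) + (Y + ?c * M * Y) * s\<^sup>2)"
        unfolding norm_mult[of ?\<delta>] by (intro mult_left_mono) auto
      have "cmod (1 + q\<^sub>0 + (q\<^sub>1 + q\<^sub>2)) \<le> 1 + ?c * ?\<zeta> + Q"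
        using one_q\<^sub>0 q\<^sub>1\<^sub>2' by (rule norm_triangle_mono)
      then show "cmod (\<rho> * (1 + q\<^sub>0 + (q\<^sub>1 + q\<^sub>2))) \<le> K * s\<^sup>2 * (1 + ?c * ?\<zeta> + Q)"
        unfolding norm_mult using \<rho>s S by (intro mult_mono) auto
    qed
    also have "\<dots> = cmod ?\<delta> * (M * ?c * \<beta> + ?\<zeta> * \<gamma> + (S + ?\<zeta> * (M + S) * ?c) * \<alpha>) + L * s\<^sup>2"
      unfolding L_def by (simp add: algebra_simps power2_eq_square)
    finally show ?thesis .
  qed
  with that L0 s\<^sub>0 show ?thesis by blast
qed

text \<open>Supplies the value of the remainder away from the origin, where only a finite bound
  depending on \<open>\<alpha>\<close>, \<open>\<beta>\<close>, \<open>\<gamma>\<close> alone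
  matters.\<close>

lemma det_perturbed_bounded:
  assumes "A \<in> carrier_mat n n" "e \<in> carrier_vec n" "c \<in> carrier_vec n"
  shows "\<exists>b. \<forall>E \<in> carrier_mat n n. \<forall>f \<in> carrier_vec n. \<forall>g \<in> carrier_vec n.
    mnorm2 E \<le> \<alpha> \<longrightarrow> vnorm2 f \<le> \<beta> \<longrightarrow> vnorm2 g \<le> \<gamma> \<longrightarrow>
    cmod (det (A + E + outer (e + f) (c + g)) - d) \<le> b"
\<comment> \<open>The witness stays schematic until the last line fixes it as
  \<open>fact n * ?k ^ n + cmod d\<close>, which mentions none of \<open>E\<close>,
  \<open>f\<close>, \<open>g\<close>.\<close>
proof (intro exI ballI impI)
  fix E f g
  assume E: "E \<in> carrier_mat n n" and f: "f \<in> carrier_vec n" and g: "g \<in> carrier_vec n"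
    and \<alpha>: "mnorm2 E \<le> \<alpha>" and \<beta>: "vnorm2 f \<le> \<beta>" and \<gamma>: "vnorm2 g \<le> \<gamma>"
  let ?k = "mnorm2 A + \<alpha> + (vnorm2 e + \<beta>) * (vnorm2 c + \<gamma>)"
  have "cmod ((A + E + outer (e + f) (c + g)) $$ (i, j)) \<le> ?k" if ij: "i < n" "j < n" for i j
  proof -
    have "(A + E + outer (e + f) (c + g)) $$ (i, j) = A $$ (i, j) + E $$ (i, j) + (e + f) $ i * (c + g) $ j"
      using ij assms E f g by (simp del: index_add_vec(1) assoc_add_mat)
    then have "cmod ((A + E + outer (e + f) (c + g)) $$ (i, j)) \<le>
        cmod (A $$ (i, j)) + cmod (E $$ (i, j)) + cmod ((e + f) $ i * (c + g) $ j)"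
      by (simp add: norm_triangle_mono norm_triangle_ineq)
    also have "\<dots> \<le> ?k"
    proof (intro add_mono)
      show "cmod (A $$ (i, j)) \<le> mnorm2 A" using ij assms by (intro cmod_index_le_mnorm2) auto
      have "cmod (E $$ (i, j)) \<le> mnorm2 E" using ij E by (intro cmod_index_le_mnorm2) auto
      then show "cmod (E $$ (i, j)) \<le> \<alpha>" using \<alpha> by simp
      have "cmod ((e + f) $ i) \<le> vnorm2 (e + f)" using ij f by (intro cmod_index_le_vnorm2) simp
      then have 1: "cmod ((e + f) $ i) \<le> vnorm2 e + \<beta>"
        using vnorm2_add_le[of e f] assms f \<beta> by simp
      have "cmod ((c + g) $ j) \<le> vnorm2 (c + g)" using ij g by (intro cmod_index_le_vnorm2) simp
      then have 2: "cmod ((c + g) $ j) \<le> vnorm2 c + \<gamma>"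
        using vnorm2_add_le[of c g] assms g \<gamma> by simp
      show "cmod ((e + f) $ i * (c + g) $ j) \<le> (vnorm2 e + \<beta>) * (vnorm2 c + \<gamma>)"
        unfolding norm_mult using 1 2 order_trans[OF norm_ge_zero 1] by (intro mult_mono) auto
    qed
    finally show ?thesis .
  qed
  then have "cmod (det (A + E + outer (e + f) (c + g))) \<le> fact n * ?k ^ n"
    using assms E f g by (intro cmod_det_le) auto
  then show "cmod (det (A + E + outer (e + f) (c + g)) - d) \<le> fact n * ?k ^ n + cmod d"
    using norm_triangle_ineq4[of "det (A + E + outer (e + f) (c + g))" d] by linarith
qed

theorem lemma3p5:
  fixes n :: nat and \<phi> :: "nat \<Rightarrow> real poly" and H C :: "complex mat"
    and c :: "complex vec" and r :: "nat \<Rightarrow> complex" and \<xi> :: complex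
  assumes "n \<ge> 1"
    and "degree_graded n \<phi>"
    and "confederate n \<phi> H"
    and "normal_mat H"
    and "c \<in> carrier_vec n"
    and "C = H - outer (unit_vec n 0) c"
    and "roots_of n \<phi> r"
    and "poly (cpoly (\<phi> n)) \<xi> \<noteq> 0"
  shows "\<exists>R :: real \<times> real \<times> real \<Rightarrow> real.
    R \<in> O[nhds (0, 0, 0)](\<lambda>(\<epsilon>\<^sub>H, \<epsilon>\<^sub>1, \<epsilon>\<^sub>c). \<epsilon>\<^sub>H\<^sup>2 + \<epsilon>\<^sub>1\<^sup>2 + \<epsilon>\<^sub>c\<^sup>2) \<and>
    (\<forall>\<epsilon>\<^sub>H \<epsilon>\<^sub>1 \<epsilon>\<^sub>c. \<forall>\<delta>H \<in> carrier_mat n n. \<forall>\<delta>e\<^sub>1 \<in> carrier_vec n. \<forall>\<delta>c \<in> carrier_vec n.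
      \<forall>\<delta>C \<in> carrier_mat n n.
        C + \<delta>C = H + \<delta>H - outer (unit_vec n 0 + \<delta>e\<^sub>1) (c + \<delta>c) \<longrightarrow>
        mnorm2 \<delta>H \<le> \<epsilon>\<^sub>H \<longrightarrow> \<epsilon>\<^sub>H < 1 \<longrightarrow> vnorm2 \<delta>c \<le> \<epsilon>\<^sub>c \<longrightarrow> vnorm2 \<delta>e\<^sub>1 \<le> \<epsilon>\<^sub>1 \<longrightarrow>
        cmod (det_poly n \<phi> (C + \<delta>C) \<xi> - det_poly n \<phi> C \<xi>)
          \<le> Gamma_1 n \<phi> r c \<xi> * \<epsilon>\<^sub>1 + Gamma_c n \<phi> \<xi> * \<epsilon>\<^sub>c + Gamma_H n \<phi> r c \<xi> * \<epsilon>\<^sub>H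
            + R (\<epsilon>\<^sub>H, \<epsilon>\<^sub>1, \<epsilon>\<^sub>c))"
proof -
  define \<nu> where "\<nu> = complex_of_real (lead_coeff (\<phi> n))"
  define A where "A = \<xi> \<cdot>\<^sub>m 1\<^sub>m n - H"
  let ?e = "unit_vec n 0 :: complex vec" and ?M = "M_max n r \<xi>" and ?S = "S_sum n r \<xi>"
  have e: "?e \<in> carrier_vec n" and c: "c \<in> carrier_vec n" using assms by auto
  have H: "H \<in> carrier_mat n n" using assms(3) by (simp add: confederate_def)
  then have A: "A \<in> carrier_mat n n" by (auto simp: A_def)
  have \<nu>0: "\<nu> \<noteq> 0" using degree_gradedD(2)[OF assms(2) order_refl] by (simp add: \<nu>_def)
  have cp: "cpoly (\<phi> n) = smult \<nu> (char_poly H)"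
    unfolding \<nu>_def using confederate_char_poly assms by blast
  have "smult \<nu> (char_poly H) = smult \<nu> (\<Prod>j=1..n. [:- r j, 1:])"
    using assms(7) cp by (simp add: roots_of_def \<nu>_def)
  then have "smult (inverse \<nu>) (smult \<nu> (char_poly H)) = smult (inverse \<nu>) (smult \<nu> (\<Prod>j=1..n. [:- r j, 1:]))"
    by (rule arg_cong)
  then have cpH: "char_poly H = (\<Prod>j=1..n. [:- r j, 1:])" using \<nu>0 by (simp del: One_nat_def)
  have \<phi>\<xi>: "poly (cpoly (\<phi> n)) \<xi> = \<nu> * det A"
    unfolding cp A_def by (simp add: poly_char_poly[OF H])
  have \<xi>r: "\<xi> \<noteq> r j" if "j \<in> {1..n}" for j
    using assms(8) that unfolding cp cpH by (auto simp: poly_prod)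
  obtain B K where B: "B \<in> carrier_mat n n" "B * A = 1\<^sub>m n" "A * B = 1\<^sub>m n"
    "\<And>v. v \<in> carrier_vec n \<Longrightarrow> vnorm2 (B *\<^sub>v v) \<le> ?M * vnorm2 v" and K: "0 \<le> K"
    "\<And>E. E \<in> carrier_mat n n \<Longrightarrow> mnorm2 E \<le> 1 \<Longrightarrow> \<exists>\<tau>. cmod \<tau> \<le> ?S * mnorm2 E \<and>
       cmod (det (A + E) - det A * (1 + \<tau>)) \<le> K * (mnorm2 E)\<^sup>2"
    using normal_mat_resolvent[OF assms(1) H assms(4) cpH \<xi>r A_def] by blast
  obtain L s\<^sub>0 where L: "0 \<le> L" "0 < s\<^sub>0"
    and bound: "\<And>E f g \<alpha> \<beta> \<gamma> s. E \<in> carrier_mat n n \<Longrightarrow> f \<in> carrier_vec n \<Longrightarrow> g \<in> carrier_vec n \<Longrightarrow>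
      mnorm2 E \<le> \<alpha> \<Longrightarrow> vnorm2 f \<le> \<beta> \<Longrightarrow> vnorm2 g \<le> \<gamma> \<Longrightarrow> \<alpha> \<le> s \<Longrightarrow> \<beta> \<le> s \<Longrightarrow> \<gamma> \<le> s \<Longrightarrow> s \<le> s\<^sub>0 \<Longrightarrow>
      cmod (det (A + E + outer (?e + f) (c + g)) - det (A + outer ?e c)) \<le>
        cmod (det A) * (?M * vnorm2 c * \<beta> + vnorm2 (B *\<^sub>v ?e) * \<gamma> +
          (?S + vnorm2 (B *\<^sub>v ?e) * (?M + ?S) * vnorm2 c) * \<alpha>) + L * s\<^sup>2"
    using det_rank_one_perturbation_bound[OF A B(1-3) M_max_nonneg[OF assms(1)] B(4) S_sum_nonneg K e c]
    by blast
  \<comment> \<open>The confederate identity says that \<open>A\<close> maps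
    \<open>Phi n \<phi> \<xi>\<close> to a multiple of \<open>?e\<close>; applying \<open>B\<close>
    converts the norm of \<open>B *\<^sub>v ?e\<close> into \<open>Gamma_c\<close>.\<close>
  have \<Gamma>c: "Gamma_c n \<phi> \<xi> = cmod \<nu> * cmod (det A) * vnorm2 (B *\<^sub>v ?e)"
  proof -
    have \<chi>0: "chi n \<phi> \<noteq> 0"
      using degree_gradedD(2)[OF assms(2)] by (simp add: chi_def)
    have "A *\<^sub>v Phi n \<phi> \<xi> = \<xi> \<cdot>\<^sub>v Phi n \<phi> \<xi> - H *\<^sub>v Phi n \<phi> \<xi>"
      unfolding A_def using H
      by (subst minus_mult_distrib_mat_vec[of _ n n]) auto
    also have "\<dots> = (inverse (chi n \<phi>) * (\<nu> * det A)) \<cdot>\<^sub>v ?e"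
      using assms(3) unfolding confederate_def \<phi>\<xi>[symmetric] by auto
    finally have A\<Phi>: "A *\<^sub>v Phi n \<phi> \<xi> = (inverse (chi n \<phi>) * (\<nu> * det A)) \<cdot>\<^sub>v ?e" .
    have "Phi n \<phi> \<xi> = B *\<^sub>v (A *\<^sub>v Phi n \<phi> \<xi>)"
      using A B(1,2) by (simp flip: assoc_mult_mat_vec)
    also have "\<dots> = (inverse (chi n \<phi>) * (\<nu> * det A)) \<cdot>\<^sub>v (B *\<^sub>v ?e)"
      unfolding A\<Phi> using B(1) by (intro mult_mat_vec) auto
    finally have "vnorm2 (Phi n \<phi> \<xi>) = cmod (inverse (chi n \<phi>) * (\<nu> * det A)) * vnorm2 (B *\<^sub>v ?e)"
      by (simp only: vnorm2_smult)
    then show ?thesis unfolding Gamma_c_def using \<chi>0 by (simp add: norm_mult norm_inverse)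
  qed
  define lin where "lin \<alpha> \<beta> \<gamma> =
    Gamma_1 n \<phi> r c \<xi> * \<beta> + Gamma_c n \<phi> \<xi> * \<gamma> + Gamma_H n \<phi> r c \<xi> * \<alpha>" for \<alpha> \<beta> \<gamma>
  have lin: "lin \<alpha> \<beta> \<gamma> = cmod \<nu> * (cmod (det A) * (?M * vnorm2 c * \<beta> + vnorm2 (B *\<^sub>v ?e) * \<gamma> +
          (?S + vnorm2 (B *\<^sub>v ?e) * (?M + ?S) * vnorm2 c) * \<alpha>))" for \<alpha> \<beta> \<gamma>
    unfolding lin_def Gamma_1_def Gamma_H_def \<Gamma>c \<phi>\<xi> by (simp add: norm_mult algebra_simps)
  \<comment> \<open>The bounds are packed into one triple so that choice yields \<open>b\<close> as
    a function of them alone.\<close>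
  have "\<forall>\<epsilon>. \<exists>b. \<forall>E \<in> carrier_mat n n. \<forall>f \<in> carrier_vec n. \<forall>g \<in> carrier_vec n.
    mnorm2 E \<le> fst \<epsilon> \<longrightarrow> vnorm2 f \<le> fst (snd \<epsilon>) \<longrightarrow> vnorm2 g \<le> snd (snd \<epsilon>) \<longrightarrow>
    cmod (det (A + E + outer (?e + f) (c + g)) - det (A + outer ?e c)) \<le> b"
    using det_perturbed_bounded[OF A e c] by blast
  then obtain b where b: "\<And>\<alpha> \<beta> \<gamma> E f g. E \<in> carrier_mat n n \<Longrightarrow> f \<in> carrier_vec n \<Longrightarrow> g \<in> carrier_vec n \<Longrightarrow>
    mnorm2 E \<le> \<alpha> \<Longrightarrow> vnorm2 f \<le> \<beta> \<Longrightarrow> vnorm2 g \<le> \<gamma> \<Longrightarrow>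
    cmod (det (A + E + outer (?e + f) (c + g)) - det (A + outer ?e c)) \<le> b (\<alpha>, \<beta>, \<gamma>)"
    unfolding choice_iff by fastforce
  \<comment> \<open>One-sided bounds suffice: the set is an open neighbourhood of the origin, and
    the norm bounds force the components to be nonnegative.\<close>
  define small where "small \<epsilon> \<longleftrightarrow> fst \<epsilon> < s\<^sub>0 \<and> fst (snd \<epsilon>) < s\<^sub>0 \<and> snd (snd \<epsilon>) < s\<^sub>0"
    for \<epsilon> :: "real \<times> real \<times> real"
  define quad where "quad = (\<lambda>(\<epsilon>\<^sub>H, \<epsilon>\<^sub>1, \<epsilon>\<^sub>c). \<epsilon>\<^sub>H\<^sup>2 + \<epsilon>\<^sub>1\<^sup>2 + \<epsilon>\<^sub>c\<^sup>2 :: real)"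
  \<comment> \<open>Away from the origin the remainder only has to make the estimate true.\<close>
  define R where "R \<epsilon> = (if small \<epsilon> then cmod \<nu> * L * quad \<epsilon>
    else cmod \<nu> * b \<epsilon> - lin (fst \<epsilon>) (fst (snd \<epsilon>)) (snd (snd \<epsilon>)))" for \<epsilon>
  have "open {\<epsilon>. small \<epsilon>}"
    unfolding small_def by (intro open_Collect_conj open_Collect_less continuous_intros)
  then have "eventually small (nhds (0, 0, 0))"
    unfolding eventually_nhds using L(2) by (intro exI[of _ "{\<epsilon>. small \<epsilon>}"]) (auto simp: small_def)
  \<comment> \<open>The filter \<open>nhds\<close> includes the origin itself, where
    \<open>R\<close> vanishes together with \<open>quad\<close>.\<close>
  then have "eventually (\<lambda>\<epsilon>. norm (R \<epsilon>) \<le> cmod \<nu> * L * norm (quad \<epsilon>)) (nhds (0, 0, 0))"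
    by eventually_elim (use L in \<open>simp add: R_def abs_mult\<close>)
  then have "R \<in> O[nhds (0, 0, 0)](quad)" by (rule bigoI)
  moreover have "cmod (det_poly n \<phi> (C + \<delta>C) \<xi> - det_poly n \<phi> C \<xi>) \<le> lin \<alpha> \<beta> \<gamma> + R (\<alpha>, \<beta>, \<gamma>)"
    if \<delta>: "\<delta>H \<in> carrier_mat n n" "f \<in> carrier_vec n" "g \<in> carrier_vec n"
      and C\<delta>: "C + \<delta>C = H + \<delta>H - outer (?e + f) (c + g)"
      and norms: "mnorm2 \<delta>H \<le> \<alpha>" "vnorm2 f \<le> \<beta>" "vnorm2 g \<le> \<gamma>"
    for \<alpha> \<beta> \<gamma> \<delta>H f g \<delta>C
  proof -
    \<comment> \<open>The perturbation of \<open>A = \<xi> I - H\<close> is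
      \<open>- \<delta>H\<close>, whereas the rank-one term, subtracted in \<open>C\<close>, is now
      added.\<close>
    let ?diff = "cmod (det (A + - \<delta>H + outer (?e + f) (c + g)) - det (A + outer ?e c))"
    have E: "- \<delta>H \<in> carrier_mat n n" "mnorm2 (- \<delta>H) \<le> \<alpha>"
      using \<delta>(1) norms(1) mnorm2_uminus_le[OF \<delta>(1)] by auto
    have "\<xi> \<cdot>\<^sub>m 1\<^sub>m n - (C + \<delta>C) = A + - \<delta>H + outer (?e + f) (c + g)"
      unfolding C\<delta> A_def using H \<delta> c by (intro eq_matI) auto
    moreover have "\<xi> \<cdot>\<^sub>m 1\<^sub>m n - C = A + outer ?e c"
      unfolding assms(6) A_def using H c by (intro eq_matI) auto
    ultimately have diff: "cmod (det_poly n \<phi> (C + \<delta>C) \<xi> - det_poly n \<phi> C \<xi>) = cmod \<nu> * ?diff"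
      unfolding det_poly_def \<nu>_def[symmetric] norm_mult[symmetric] right_diff_distrib by simp
    show ?thesis
    proof (cases "small (\<alpha>, \<beta>, \<gamma>)")
      case True
      define s where "s = max \<alpha> (max \<beta> \<gamma>)"
      have "?diff \<le> cmod (det A) * (?M * vnorm2 c * \<beta> + vnorm2 (B *\<^sub>v ?e) * \<gamma> +
          (?S + vnorm2 (B *\<^sub>v ?e) * (?M + ?S) * vnorm2 c) * \<alpha>) + L * s\<^sup>2"
        using True by (intro bound E \<delta> norms) (auto simp: s_def small_def)
      \<comment> \<open>The square of the maximum is one of the three summands of
        \<open>quad\<close>.\<close>
      also have "L * s\<^sup>2 \<le> L * quad (\<alpha>, \<beta>, \<gamma>)"
        using L(1) by (intro mult_left_mono) (auto simp: s_def quad_def max_def)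
      finally have "cmod \<nu> * ?diff \<le> lin \<alpha> \<beta> \<gamma> + cmod \<nu> * (L * quad (\<alpha>, \<beta>, \<gamma>))"
        unfolding lin distrib_left[symmetric] by (intro mult_left_mono) auto
      then show ?thesis unfolding diff R_def using True by (simp add: mult.assoc)
    next
      case False
      have "cmod \<nu> * ?diff \<le> cmod \<nu> * b (\<alpha>, \<beta>, \<gamma>)"
        by (intro mult_left_mono b E \<delta> norms) auto
      then show ?thesis unfolding diff R_def using False by simp
    qed
  qed
  ultimately show ?thesis unfolding quad_def lin_def by (intro exI[of _ R]) blast
qed

end
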